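(* The following bounds hold: $$0 < Q(t) \le 2.714\,\frac{1}{t}e^{-t} \quad \text{for all } t \ge 2.5,$$ and $$3Q(t)^2 \le e^{-2t} \quad \text{for all } t \ge 5.$$
   Context: $Q(t)$, $t\ge 0$, denotes the radial profile of the positive radial ground state of $\Delta\phi - \phi + |\phi|^2\phi = 0$ on $\mathbb{R}^3$; it solves $-Q'' - \frac{2}{t}Q' + Q - Q^3 = 0$. *)

theory Defs
  imports "HOL-Analysis.Analysis"
begin

text \<open>Q is the radial profile of the positive radial ground state of
  \<Delta>phi - phi + |phi|^2 phi = 0 on R^3: Q is C^1 on [0,oo) with Q'(0) = 0
  (regularity at the origin), twice differentiable on (0,oo), solves
  -Q'' - (2/t) Q' + Q - Q^3 = 0 there, is positive, and decays to 0 at infinity.\<close>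
definition ground_state_profile :: "(real \<Rightarrow> real) \<Rightarrow> bool" where
  "ground_state_profile Q \<longleftrightarrow>
     (\<exists>Q' Q''.
        (\<forall>t\<ge>0. (Q has_real_derivative Q' t) (at t within {0..})) \<and>
        continuous_on {0..} Q' \<and>
        Q' 0 = 0 \<and>
        (\<forall>t>0. (Q' has_real_derivative Q'' t) (at t)) \<and>
        (\<forall>t>0. - Q'' t - (2 / t) * Q' t + Q t - (Q t) ^ 3 = 0) \<and>
        (\<forall>t\<ge>0. Q t > 0) \<and>
        (Q \<longlongrightarrow> 0) at_top)"

end

theory Submission
  imports Defs "HOL-Real_Asymp.Real_Asymp"
begin

text \<open>Since \<open>t Q e\<^sup>t\<close> increases, it suffices to exclude that it ever exceeds 2.714; its limit for the actual ground
  state is about 2.7128. Put \<open>q = Q' / Q\<close> and let \<open>H\<close> be the Pohozaev function for the weight \<open>t\<^sup>2\<^sup>/\<^sup>3\<close>, normalised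
  by \<open>(t Q)\<^sup>2\<close>; it is nonnegative, because the weighted function vanishes at 0 and at infinity and changes its
  monotonicity once. For a second solution with logarithmic derivative \<open>p\<close> and Pohozaev function \<open>h\<close>, the pair
  \<open>(q - p, H - h)\<close> satisfies a linear system whose off-diagonal coefficients are \<open>- 2\<close> and \<open>- 2 H\<close>, so that positivity
  of both components propagates from infinity to 0; this remains true if \<open>p\<close> is merely a subsolution in a suitable
  sense. If \<open>t Q e\<^sup>t\<close> exceeds 2.714 somewhere, both components are positive near infinity for an explicit
  subsolution that decays like \<open>2.714 e\<^sup>-\<^sup>t / t\<close>. Continued by piecewise polynomials, this subsolution satisfies \<open>p > 0\<close>
  at \<open>t = 0.01\<close>, whereas \<open>q \<le> 0\<close> everywhere.\<close>

section \<open>Differential inequalities\<close>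

lemma has_derivative_nonpos_imp_ge:
  fixes f :: "real \<Rightarrow> real"
  assumes "a \<le> b" "\<And>t. t \<in> {a..b} \<Longrightarrow> (f has_real_derivative f' t) (at t)"
    "\<And>t. t \<in> {a..b} \<Longrightarrow> f' t \<le> 0"
  shows "f b \<le> f a"
  by (rule DERIV_nonpos_imp_nonincreasing[OF assms(1)]) (meson assms(2,3) atLeastAtMost_iff)

lemma has_derivative_nonneg_imp_le:
  fixes f :: "real \<Rightarrow> real"
  assumes "a \<le> b" "\<And>t. t \<in> {a..b} \<Longrightarrow> (f has_real_derivative f' t) (at t)"
    "\<And>t. t \<in> {a..b} \<Longrightarrow> 0 \<le> f' t"
  shows "f a \<le> f b"
  by (rule DERIV_nonneg_imp_nondecreasing[OF assms(1)]) (meson assms(2,3) atLeastAtMost_iff)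

text \<open>While both components are nonnegative the coupling terms only help, so with
  \<open>K\<close> bounding the diagonal coefficients neither \<open>x t * exp (- K * t)\<close> nor
  its analogue for \<open>y\<close> increases. Going backwards, neither component can reach
  0.\<close>

lemma positive_quadrant_backward_invariant:
  fixes x y :: "real \<Rightarrow> real"
  assumes ab: "a \<le> b"
    and x: "\<And>t. t \<in> {a..b} \<Longrightarrow> (x has_real_derivative x' t) (at t)"
    and y: "\<And>t. t \<in> {a..b} \<Longrightarrow> (y has_real_derivative y' t) (at t)"
    and x': "\<And>t. t \<in> {a<..<b} \<Longrightarrow> x' t \<le> \<alpha> t * x t - \<mu> t * y t"
    and y': "\<And>t. t \<in> {a<..<b} \<Longrightarrow> y' t \<le> \<beta> t * y t - \<nu> t * x t"
    and \<mu>: "\<And>t. t \<in> {a<..<b} \<Longrightarrow> 0 \<le> \<mu> t"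
    and \<nu>: "\<And>t. t \<in> {a<..<b} \<Longrightarrow> 0 \<le> \<nu> t"
    and \<alpha>: "continuous_on {a..b} \<alpha>" and \<beta>: "continuous_on {a..b} \<beta>"
    and b: "0 < x b" "0 < y b"
  shows "0 < x a \<and> 0 < y a"
proof -
  have "compact (\<alpha> ` {a..b} \<union> \<beta> ` {a..b})"
    by (intro compact_Un compact_continuous_image \<alpha> \<beta> compact_Icc)
  then obtain K where "\<forall>s \<in> \<alpha> ` {a..b} \<union> \<beta> ` {a..b}. norm s \<le> K"
    by (meson bounded_iff compact_imp_bounded)
  then have K: "\<bar>\<alpha> t\<bar> \<le> K \<and> \<bar>\<beta> t\<bar> \<le> K" if "t \<in> {a..b}" for t
    using that by simp
  have step: "x b * exp (- K * b) \<le> x s * exp (- K * s) \<and> y b * exp (- K * b) \<le> y s * exp (- K * s)"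
    if s: "a \<le> s" "s \<le> b" and pos: "\<And>t. s < t \<Longrightarrow> t \<le> b \<Longrightarrow> 0 \<le> x t \<and> 0 \<le> y t" for s
  proof
    have D: "x' t \<le> K * x t \<and> y' t \<le> K * y t" if "s < t" "t < b" for t
    proof -
      have t: "t \<in> {a<..<b}" and xy: "0 \<le> x t" "0 \<le> y t" using that s pos by auto
      have "\<alpha> t * x t \<le> K * x t" "\<beta> t * y t \<le> K * y t"
        using K[of t] t xy by (auto intro!: mult_right_mono)
      moreover have "0 \<le> \<mu> t * y t" "0 \<le> \<nu> t * x t" using \<mu>[OF t] \<nu>[OF t] xy by auto
      ultimately show ?thesis using x'[OF t] y'[OF t] by auto
    qed
    have cont: "continuous_on {s..b} x" "continuous_on {s..b} y"
      using s by (auto intro!: continuous_at_imp_continuous_on DERIV_isCont[OF x] DERIV_isCont[OF y])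
    show "x b * exp (- K * b) \<le> x s * exp (- K * s)"
    proof (rule DERIV_nonpos_imp_decreasing_open[OF s(2)])
      fix t assume t: "s < t" "t < b"
      have "((\<lambda>t. x t * exp (- K * t)) has_real_derivative (x' t - K * x t) * exp (- K * t)) (at t)"
        using t s by (auto intro!: derivative_eq_intros x simp: algebra_simps)
      moreover have "(x' t - K * x t) * exp (- K * t) \<le> 0" using D[OF t] by (simp add: mult_le_0_iff)
      ultimately show "\<exists>z. ((\<lambda>t. x t * exp (- K * t)) has_real_derivative z) (at t) \<and> z \<le> 0" by blast
    qed (intro continuous_intros cont)
    show "y b * exp (- K * b) \<le> y s * exp (- K * s)"
    proof (rule DERIV_nonpos_imp_decreasing_open[OF s(2)])
      fix t assume t: "s < t" "t < b"
      have "((\<lambda>t. y t * exp (- K * t)) has_real_derivative (y' t - K * y t) * exp (- K * t)) (at t)"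
        using t s by (auto intro!: derivative_eq_intros y simp: algebra_simps)
      moreover have "(y' t - K * y t) * exp (- K * t) \<le> 0" using D[OF t] by (simp add: mult_le_0_iff)
      ultimately show "\<exists>z. ((\<lambda>t. y t * exp (- K * t)) has_real_derivative z) (at t) \<and> z \<le> 0" by blast
    qed (intro continuous_intros cont)
  qed
  have step': "0 < x s \<and> 0 < y s"
    if "a \<le> s" "s \<le> b" "\<And>t. s < t \<Longrightarrow> t \<le> b \<Longrightarrow> 0 \<le> x t \<and> 0 \<le> y t" for s
  proof -
    have "0 < x s * exp (- K * s)" "0 < y s * exp (- K * s)"
      using step[OF that] b by (meson exp_gt_zero less_le_trans mult_pos_pos)+
    then show ?thesis by (simp add: zero_less_mult_iff)
  qed
  have contm: "continuous_on {a..b} (\<lambda>t. min (x t) (y t))"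
    using x y by (intro continuous_on_min continuous_at_imp_continuous_on ballI) (blast intro: DERIV_isCont)+
  have "0 \<le> min (x t) (y t)" if t: "t \<in> {a..b}" for t
  proof (rule ccontr)
    assume neg: "\<not> 0 \<le> min (x t) (y t)"
    define B where "B = {s \<in> {a..b}. min (x s) (y s) \<le> 0}"
    have "closed B" unfolding B_def
      by (intro continuous_on_closed_Collect_le contm continuous_intros closed_atLeastAtMost)
    moreover have "t \<in> B" "B \<subseteq> {a..b}" using neg t by (auto simp: B_def)
    moreover from this have bdd: "bdd_above B" by (meson bdd_above_Icc bdd_above_mono)
    ultimately have SB: "Sup B \<in> B" using closed_contains_Sup[of B] by blast
    have "0 \<le> x s \<and> 0 \<le> y s" if "Sup B < s" "s \<le> b" for s
    proof -
      have "s \<notin> B" using that bdd cSup_upper by fastforce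
      then show ?thesis using that SB by (auto simp: B_def)
    qed
    then have "0 < x (Sup B) \<and> 0 < y (Sup B)"
      using SB by (intro step') (auto simp: B_def)
    then show False using SB by (auto simp: B_def)
  qed
  then have "0 \<le> x t \<and> 0 \<le> y t" if "a < t" "t \<le> b" for t using that by fastforce
  then show ?thesis using step'[of a] ab by blast
qed

text \<open>At the last point with \<open>f t \<le> 0\<close> the derivative is negative, so
  \<open>f\<close> stays nonpositive a little longer.\<close>

lemma nonpos_forward_invariant:
  fixes f :: "real \<Rightarrow> real"
  assumes f: "\<And>t. s \<le> t \<Longrightarrow> (f has_real_derivative f' t) (at t)"
    and neg: "\<And>t. s \<le> t \<Longrightarrow> f t \<le> 0 \<Longrightarrow> f' t < 0"
    and s: "f s \<le> 0" and t: "s \<le> t"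
  shows "f t \<le> 0"
proof (rule ccontr)
  assume pos: "\<not> f t \<le> 0"
  have cont: "continuous_on {s..t} f"
    using f by (intro continuous_at_imp_continuous_on ballI) (auto intro: DERIV_isCont)
  define B where "B = {r \<in> {s..t}. f r \<le> 0}"
  have "closed B" unfolding B_def
    by (intro continuous_on_closed_Collect_le cont continuous_intros closed_atLeastAtMost)
  moreover have "s \<in> B" "B \<subseteq> {s..t}" using s t by (auto simp: B_def)
  moreover from this have bdd: "bdd_above B" by (meson bdd_above_Icc bdd_above_mono)
  ultimately have r: "Sup B \<in> B" using closed_contains_Sup[of B] by blast
  then have "Sup B < t" using pos by (cases "Sup B = t") (auto simp: B_def)
  have "f' (Sup B) < 0" using r neg by (auto simp: B_def)
  then obtain d where d: "0 < d" "\<And>h. 0 < h \<Longrightarrow> h < d \<Longrightarrow> f (Sup B + h) < f (Sup B)"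
    using DERIV_neg_dec_right[OF f[of "Sup B"]] r unfolding B_def by auto
  define h where "h = min (d / 2) (t - Sup B)"
  have h: "0 < h" "h < d" "h \<le> t - Sup B" using d(1) \<open>Sup B < t\<close> by (auto simp: h_def)
  have "Sup B + h \<in> B" using d(2)[OF h(1,2)] r h by (auto simp: B_def)
  then show False using bdd cSup_upper h by fastforce
qed

text \<open>A nonpositive value would persist, so \<open>f\<close> would decrease strictly from
  \<open>s\<close> on; but then the limit 0 lies below \<open>f s\<close>.\<close>

lemma positive_if_tendsto_0:
  fixes f :: "real \<Rightarrow> real"
  assumes f: "\<And>t. s \<le> t \<Longrightarrow> (f has_real_derivative f' t) (at t)"
    and neg: "\<And>t. s \<le> t \<Longrightarrow> f t \<le> 0 \<Longrightarrow> f' t < 0"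
    and lim: "(f \<longlongrightarrow> 0) at_top"
  shows "0 < f s"
proof (rule ccontr)
  assume "\<not> 0 < f s"
  then have le: "f t \<le> 0" if "s \<le> t" for t
    using nonpos_forward_invariant[of s f f' t] f neg that by simp
  have "0 < f s"
    by (rule DERIV_neg_imp_decreasing_at_top[OF _ lim]) (use f neg le in blast)
  then show False using le[of s] by simp
qed

section \<open>Ground states\<close>

locale ground_state =
  fixes Q Q1 Q2 :: "real \<Rightarrow> real"
  assumes Q_deriv_within: "\<And>t. 0 \<le> t \<Longrightarrow> (Q has_real_derivative Q1 t) (at t within {0..})"
    and Q1_cont: "continuous_on {0..} Q1"
    and Q1_0: "Q1 0 = 0"
    and Q1_deriv [derivative_intros]: "\<And>t. 0 < t \<Longrightarrow> (Q1 has_real_derivative Q2 t) (at t)"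
    and ode: "\<And>t. 0 < t \<Longrightarrow> - Q2 t - (2 / t) * Q1 t + Q t - Q t ^ 3 = 0"
    and Q_pos: "\<And>t. 0 \<le> t \<Longrightarrow> 0 < Q t"
    and Q_lim: "(Q \<longlongrightarrow> 0) at_top"
begin

lemma Q2_eq: "0 < t \<Longrightarrow> Q2 t = Q t - Q t ^ 3 - 2 / t * Q1 t"
  using ode[of t] by simp

lemma Q_deriv: "0 < t \<Longrightarrow> (Q has_real_derivative Q1 t) (at t)"
  using Q_deriv_within[of t] at_within_interior[of t "{0..}"] by simp

lemma Q_cont: "continuous_on {0..} Q"
  by (meson DERIV_continuous Q_deriv_within atLeast_iff continuous_on_eq_continuous_within)

section \<open>The reduced function \<open>t Q\<close> and its exponential decay\<close>

definition u :: "real \<Rightarrow> real" where "u t = t * Q t"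
definition u1 :: "real \<Rightarrow> real" where "u1 t = Q t + t * Q1 t"

lemma u_pos: "0 < t \<Longrightarrow> 0 < u t"
  using Q_pos by (simp add: u_def)

lemma u_deriv: "0 < t \<Longrightarrow> (u has_real_derivative u1 t) (at t)"
  unfolding u_def[abs_def] u1_def by (auto intro!: derivative_eq_intros Q_deriv)

lemma u1_deriv: "0 < t \<Longrightarrow> (u1 has_real_derivative u t * (1 - Q t ^ 2)) (at t)"
  unfolding u1_def[abs_def] u_def
  by (rule derivative_eq_intros Q_deriv refl | assumption)+
    (simp add: Q2_eq field_simps power2_eq_square power3_eq_cube)

lemma Q_small: "0 < e \<Longrightarrow> \<forall>\<^sub>F t in at_top. Q t < e"
  using Q_lim order_tendstoD(2) by blast

text \<open>This is the monotonicity of \<open>u t * exp t\<close>. If it fails, the strictly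
  decreasing function \<open>exp (- t) * (u1 t + u t)\<close> eventually stays below a negative
  constant, and \<open>u\<close> falls at least linearly to 0.\<close>

lemma u_plus_u1_pos:
  assumes "0 < t"
  shows "0 < u1 t + u t"
proof (rule ccontr)
  define f where "f t = exp (- t) * (u1 t + u t)" for t
  have f: "(f has_real_derivative - exp (- t) * u t * Q t ^ 2) (at t)" if "0 < t" for t
    unfolding f_def[abs_def]
    by (auto intro!: derivative_eq_intros u_deriv u1_deriv that simp: algebra_simps)
  have neg: "- exp (- t) * u t * Q t ^ 2 < 0" if "0 < t" for t
    using u_pos[OF that] Q_pos[of t] that by simp
  assume "\<not> ?thesis"
  then have "f t \<le> 0" by (simp add: f_def mult_le_0_iff)
  moreover have "f (t + 1) < f t"
  proof (rule DERIV_neg_imp_decreasing[of t "t + 1" f])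
    fix r assume "t \<le> r"
    then have "0 < r" using assms by simp
    then show "\<exists>y. (f has_real_derivative y) (at r) \<and> y < 0" using f[of r] neg[of r] by blast
  qed simp
  ultimately have f1: "f (t + 1) < 0" by simp
  have fle: "f s \<le> f (t + 1)" if "t + 1 \<le> s" for s
    by (rule has_derivative_nonpos_imp_ge[OF that f]) (use assms that neg[THEN less_imp_le] in auto)
  have u1: "u1 s \<le> f (t + 1)" if "t + 1 \<le> s" for s
  proof -
    have "u1 s + u s = exp s * f s" by (simp add: f_def exp_minus)
    also have "\<dots> \<le> exp s * f (t + 1)" using fle[OF that] by simp
    also have "\<dots> \<le> f (t + 1)" using f1 that assms by simp
    finally show ?thesis using u_pos[of s] that assms by simp
  qed
  \<comment> \<open>The zero of the line through \<open>(t + 1, u (t + 1))\<close> with slope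
    \<open>f (t + 1)\<close>, which bounds \<open>u\<close> from above.\<close>
  define s where "s = t + 1 - u (t + 1) / f (t + 1)"
  have s: "t + 1 \<le> s" using u_pos[of "t + 1"] assms f1 by (simp add: s_def divide_nonneg_neg)
  have "u s - f (t + 1) * s \<le> u (t + 1) - f (t + 1) * (t + 1)"
  proof (rule DERIV_nonpos_imp_nonincreasing[OF s])
    fix r assume r: "t + 1 \<le> r" "r \<le> s"
    show "\<exists>y. ((\<lambda>s. u s - f (t + 1) * s) has_real_derivative y) (at r) \<and> y \<le> 0"
      by (rule exI[of _ "u1 r - f (t + 1)"])
        (use r assms u1 in \<open>auto intro!: derivative_eq_intros u_deriv\<close>)
  qed
  then have "u s \<le> 0" using f1 by (simp add: s_def field_simps)
  then show False using u_pos[of s] s assms by simp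
qed

text \<open>Once \<open>Q^2 \<le> 1 - l^2\<close>, the function \<open>v = u1 + l * u\<close>
  satisfies \<open>v' \<ge> l * v\<close>. A positive value would grow exponentially, whereas
  \<open>u t < t\<close>.\<close>

lemma u1_le:
  assumes l: "0 < l" "l < 1"
  shows "\<forall>\<^sub>F t in at_top. u1 t + l * u t \<le> 0"
proof -
  have "0 < 1 - l\<^sup>2" using l by (simp add: power_less_one_iff abs_square_less_1)
  then have "\<forall>\<^sub>F t in at_top. Q t < sqrt (1 - l\<^sup>2)" by (intro Q_small) simp
  then have "\<forall>\<^sub>F t in at_top. 0 < t \<and> Q t < 1 \<and> Q t < sqrt (1 - l\<^sup>2)"
    using Q_small[OF zero_less_one] eventually_gt_at_top[of 0] by eventually_elim auto
  then obtain T where T: "\<And>t. T \<le> t \<Longrightarrow> 0 < t \<and> Q t < 1 \<and> Q t < sqrt (1 - l\<^sup>2)"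
    by (auto simp: eventually_at_top_linorder)
  define v where "v t = u1 t + l * u t" for t
  have v': "(v has_real_derivative u t * (1 - Q t ^ 2) + l * u1 t) (at t)" if "0 < t" for t
    unfolding v_def[abs_def] by (auto intro!: derivative_eq_intros u_deriv u1_deriv that)
  have "v s \<le> 0" if s: "T \<le> s" for s
  proof (rule ccontr)
    assume "\<not> v s \<le> 0"
    then have vs: "0 < v s" by simp
    have s0: "0 < s" using T[OF s] by simp
    have vge: "v s * exp (l * (t - s)) \<le> v t" if "s \<le> t" for t
    proof -
      have "v s * exp (- l * s) \<le> v t * exp (- l * t)"
      proof (rule DERIV_nonneg_imp_nondecreasing[OF that])
        fix r assume r: "s \<le> r" "r \<le> t"
        have r0: "0 < r" using r s0 by simp
        have "Q r ^ 2 \<le> (sqrt (1 - l\<^sup>2))\<^sup>2"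
          using T[of r] r s Q_pos[of r] by (intro power_mono) auto
        also have "\<dots> = 1 - l\<^sup>2" using \<open>0 < 1 - l\<^sup>2\<close> by simp
        finally have "l\<^sup>2 * u r \<le> u r * (1 - Q r ^ 2)"
          using u_pos[OF r0] by simp
        then have "0 \<le> (u r * (1 - Q r ^ 2) + l * u1 r - l * v r) * exp (- l * r)"
          by (intro mult_nonneg_nonneg) (simp_all add: v_def algebra_simps power2_eq_square)
        moreover have "((\<lambda>t. v t * exp (- l * t)) has_real_derivative
            (u r * (1 - Q r ^ 2) + l * u1 r - l * v r) * exp (- l * r)) (at r)"
          by (auto intro!: derivative_eq_intros v' r0 simp: algebra_simps)
        ultimately show "\<exists>y. ((\<lambda>t. v t * exp (- l * t)) has_real_derivative y) (at r) \<and> 0 \<le> y"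
          by blast
      qed
      then have "v s * exp (- l * s) * exp (l * t) \<le> v t * exp (- l * t) * exp (l * t)"
        by (rule mult_right_mono) simp
      then show ?thesis by (simp add: mult.assoc flip: exp_add) (simp add: algebra_simps)
    qed
    \<comment> \<open>This yields \<open>u1 \<ge> 2\<close> eventually; any slope bound above 1
      contradicts \<open>u t < t\<close>.\<close>
    have "filterlim (\<lambda>t. v s * exp (l * (t - s)) - l * t) at_top at_top"
      using vs l by real_asymp
    then have "\<forall>\<^sub>F t in at_top. 2 \<le> v s * exp (l * (t - s)) - l * t"
      by (simp add: filterlim_at_top)
    then obtain R where R: "\<And>t. R \<le> t \<Longrightarrow> 2 \<le> v s * exp (l * (t - s)) - l * t"
      by (auto simp: eventually_at_top_linorder)
    define r where "r = max R s"
    have u1: "2 \<le> u1 t" if "r \<le> t" for t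
    proof -
      have "s \<le> t" "R \<le> t" using that by (auto simp: r_def)
      moreover have "l * u t \<le> l * t"
        using T[of t] \<open>s \<le> t\<close> s l by (simp add: u_def)
      ultimately show ?thesis using vge[of t] R[of t] by (simp add: v_def)
    qed
    have rs: "s \<le> r" by (simp add: r_def)
    \<comment> \<open>From \<open>r\<close> on \<open>u\<close> has slope at least 2, so
      \<open>u m > 2 * (m - r) = m + 1\<close>.\<close>
    define m where "m = 2 * r + 1"
    have m: "r \<le> m" using rs s0 by (simp add: m_def)
    have "u r - 2 * r \<le> u m - 2 * m"
    proof (rule DERIV_nonneg_imp_nondecreasing[OF m])
      fix t assume t: "r \<le> t" "t \<le> m"
      show "\<exists>y. ((\<lambda>t. u t - 2 * t) has_real_derivative y) (at t) \<and> 0 \<le> y"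
        by (rule exI[of _ "u1 t - 2"])
          (use t u1 rs s0 in \<open>auto intro!: derivative_eq_intros u_deriv\<close>)
    qed
    moreover have "u m < m" using T[of m] m rs s by (simp add: u_def)
    moreover have "0 < u r" using u_pos rs s0 by simp
    ultimately show False by (simp add: m_def)
  qed
  then show ?thesis unfolding v_def by (auto simp: eventually_at_top_linorder)
qed

lemma u_exp_bound:
  obtains C where "0 < C" "\<forall>\<^sub>F t in at_top. 0 < u t \<and> u t \<le> C * exp (- t / 2) \<and> \<bar>u1 t\<bar> \<le> u t"
proof -
  have "\<forall>\<^sub>F t in at_top. 0 < t \<and> u1 t + 1 / 2 * u t \<le> 0"
    by (intro eventually_conj eventually_gt_at_top u1_le) auto
  then obtain T where T: "\<And>t. T \<le> t \<Longrightarrow> 0 < t \<and> u1 t + 1 / 2 * u t \<le> 0"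
    by (auto simp: eventually_at_top_linorder)
  have T0: "0 < T" using T[of T] by simp
  have "u t * exp (t / 2) \<le> u T * exp (T / 2)" if t: "T \<le> t" for t
  proof (rule DERIV_nonpos_imp_nonincreasing[OF t])
    fix r assume r: "T \<le> r" "r \<le> t"
    have "((\<lambda>t. u t * exp (t / 2)) has_real_derivative (u1 r + 1 / 2 * u r) * exp (r / 2)) (at r)"
      using T[OF r(1)] by (auto intro!: derivative_eq_intros u_deriv simp: algebra_simps)
    moreover have "(u1 r + 1 / 2 * u r) * exp (r / 2) \<le> 0"
      using T[OF r(1)] by (simp add: mult_le_0_iff)
    ultimately show "\<exists>y. ((\<lambda>t. u t * exp (t / 2)) has_real_derivative y) (at r) \<and> y \<le> 0" by blast
  qed
  then have "u t \<le> u T * exp (T / 2) * exp (- t / 2)" if "T \<le> t" for t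
    using that by (simp add: exp_minus field_simps)
  moreover have "\<bar>u1 t\<bar> \<le> u t" "0 < u t" if "T \<le> t" for t
    using T[OF that] u_plus_u1_pos[of t] u_pos[of t] by auto
  ultimately have "\<forall>\<^sub>F t in at_top. 0 < u t \<and> u t \<le> u T * exp (T / 2) * exp (- t / 2) \<and> \<bar>u1 t\<bar> \<le> u t"
    by (auto intro!: eventually_at_top_linorderI[of T])
  then show thesis using that[of "u T * exp (T / 2)"] u_pos[OF T0] by simp
qed

section \<open>Energy and monotonicity of the profile\<close>

lemma Q1_lim: "(Q1 \<longlongrightarrow> 0) at_top"
proof (rule Lim_null_comparison)
  obtain C where "\<forall>\<^sub>F t in at_top. 0 < u t \<and> u t \<le> C * exp (- t / 2) \<and> \<bar>u1 t\<bar> \<le> u t"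
    using u_exp_bound by blast
  then show "\<forall>\<^sub>F t in at_top. norm (Q1 t) \<le> 2 * Q t"
    using eventually_ge_at_top[of 1]
  proof eventually_elim
    case (elim t)
    then have "0 < Q t" using Q_pos by simp
    have "Q t \<le> t * Q t" using elim \<open>0 < Q t\<close> by simp
    moreover have "\<bar>Q t + t * Q1 t\<bar> \<le> t * Q t" using elim by (simp add: u_def u1_def)
    ultimately have "\<bar>t * Q1 t\<bar> \<le> t * (2 * Q t)" using \<open>0 < Q t\<close> by linarith
    then show ?case using elim by (simp add: abs_mult)
  qed
  show "((\<lambda>t. 2 * Q t) \<longlongrightarrow> 0) at_top"
    by (rule tendsto_eq_intros Q_lim refl)+ simp
qed

text \<open>The energy is dissipated at the rate \<open>2 * Q1 t ^ 2 / t\<close> and tends to 0 at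
  infinity.\<close>

lemma energy_nonneg:
  assumes "0 \<le> t"
  shows "0 \<le> Q1 t ^ 2 / 2 + Q t ^ 4 / 4 - Q t ^ 2 / 2"
proof -
  define E where "E t = Q1 t ^ 2 / 2 + Q t ^ 4 / 4 - Q t ^ 2 / 2" for t
  have cont: "continuous_on {0..} E"
    unfolding E_def[abs_def] by (intro continuous_intros Q_cont Q1_cont) auto
  have E': "(E has_real_derivative - 2 * Q1 t ^ 2 / t) (at t)" if "0 < t" for t
    unfolding E_def[abs_def] using that
    by (auto intro!: derivative_eq_intros Q_deriv
        simp: Q2_eq field_simps power2_eq_square power3_eq_cube)
  have "E s \<le> E t" if "t \<le> s" for s
  proof (rule DERIV_nonpos_imp_decreasing_open[OF that])
    fix r assume "t < r" "r < s"
    then have "0 < r" using assms by simp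
    then show "\<exists>y. (E has_real_derivative y) (at r) \<and> y \<le> 0"
      by (intro exI[of _ "- 2 * Q1 r ^ 2 / r"] conjI E') simp_all
  next
    show "continuous_on {t..s} E" by (rule continuous_on_subset[OF cont]) (use assms in auto)
  qed
  then have "\<forall>\<^sub>F s in at_top. E s \<le> E t" by (rule eventually_at_top_linorderI)
  moreover have "(E \<longlongrightarrow> 0) at_top"
    unfolding E_def[abs_def] by (auto intro!: tendsto_eq_intros Q_lim Q1_lim)
  ultimately have "0 \<le> E t" by (metis tendsto_upperbound trivial_limit_at_top_linorder)
  then show ?thesis by (simp add: E_def)
qed

text \<open>On a maximal interval of increase the flux \<open>t\<^sup>2 Q'\<close> starts at 0 and must grow, so \<open>Q < 1\<close>
  at its left end; there the energy would be negative.\<close>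

lemma Q1_nonpos:
  assumes s: "0 < s"
  shows "Q1 s \<le> 0"
proof (rule ccontr)
  assume pos: "\<not> Q1 s \<le> 0"
  define B where "B = {r \<in> {0..s}. Q1 r \<le> 0}"
  have "continuous_on {0..s} Q1" by (rule continuous_on_subset[OF Q1_cont]) auto
  then have "closed B" unfolding B_def
    by (intro continuous_on_closed_Collect_le continuous_intros closed_atLeastAtMost)
  moreover have "0 \<in> B" "B \<subseteq> {0..s}" using s Q1_0 by (auto simp: B_def)
  moreover from this have bdd: "bdd_above B" by (meson bdd_above_Icc bdd_above_mono)
  ultimately have SB: "Sup B \<in> B" using closed_contains_Sup[of B] by blast
  define r where "r = Sup B"
  have r: "0 \<le> r" "r \<le> s" "Q1 r \<le> 0" using SB by (auto simp: B_def r_def)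
  then have rs: "r < s" using pos by (cases "r = s") auto
  have Q1pos: "0 < Q1 t" if "r < t" "t \<le> s" for t
  proof (rule ccontr)
    assume "\<not> 0 < Q1 t"
    then have "t \<in> B" using that r by (simp add: B_def)
    then show False using cSup_upper[OF _ bdd, of t] that by (simp add: r_def)
  qed
  define f where "f t = t ^ 2 * Q1 t" for t
  have f': "(f has_real_derivative t ^ 2 * Q t * (1 - Q t ^ 2)) (at t)" if "0 < t" for t
    unfolding f_def[abs_def] using that
    by (auto intro!: derivative_eq_intros simp: Q2_eq field_simps power2_eq_square power3_eq_cube)
  have "\<exists>l z. r < z \<and> z < s \<and> (f has_real_derivative l) (at z) \<and> f s - f r = (s - r) * l"
  proof (rule MVT[OF rs])
    show "continuous_on {r..s} f"
      unfolding f_def[abs_def] using r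
      by (intro continuous_intros continuous_on_subset[OF Q1_cont]) auto
    show "f differentiable (at x)" if "r < x" "x < s" for x
      using f'[of x] that r by (auto simp: real_differentiable_def)
  qed
  then obtain l z where z: "r < z" "z < s" "(f has_real_derivative l) (at z)" "f s - f r = (s - r) * l"
    by blast
  have z0: "0 < z" using z r by simp
  have "0 < f s" using Q1pos[of s] rs s by (simp add: f_def)
  moreover have "f r \<le> 0" using r by (simp add: f_def mult_le_0_iff)
  ultimately have "0 < (s - r) * l" using z(4) by simp
  then have "0 < l" using rs by (simp add: zero_less_mult_iff)
  moreover have "l = z ^ 2 * Q z * (1 - Q z ^ 2)" using DERIV_unique[OF z(3) f'[OF z0]] .
  moreover have "0 < z ^ 2 * Q z" using z0 Q_pos[of z] by simp
  ultimately have "Q z ^ 2 < 1" using zero_less_mult_pos[of "z ^ 2 * Q z" "1 - Q z ^ 2"] by simp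
  then have Qz: "Q z < 1" using Q_pos[of z] z0 by (simp add: power_less_one_iff)
  have "Q r \<le> Q z"
  proof (rule DERIV_nonneg_imp_increasing_open[of r z Q])
    show "continuous_on {r..z} Q" by (rule continuous_on_subset[OF Q_cont]) (use r in auto)
    show "\<exists>y. (Q has_real_derivative y) (at x) \<and> 0 \<le> y" if "r < x" "x < z" for x
      using Q_deriv[of x] Q1pos[of x] that r z by (intro exI[of _ "Q1 x"]) auto
  qed (use z in simp)
  then have Qr: "0 < Q r" "Q r < 1" using Qz Q_pos r by auto
  have "0 \<le> Q1 r"
  proof (rule tendsto_lowerbound)
    show "(Q1 \<longlongrightarrow> Q1 r) (at_right r)"
      using Q1_cont r by (auto simp: continuous_on_def intro: tendsto_within_subset)
    show "\<forall>\<^sub>F t in at_right r. 0 \<le> Q1 t"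
      using eventually_at_right_real[OF rs] Q1pos by (auto elim!: eventually_mono intro: less_imp_le)
  qed simp
  then have "Q1 r ^ 2 = 0" using r by simp
  moreover have "Q r ^ 4 < Q r ^ 2"
    using Qr by (intro power_strict_decreasing) auto
  moreover have "0 < Q r ^ 2" using Qr by simp
  ultimately show False using energy_nonneg[OF r(1)] by linarith
qed

section \<open>The Pohozaev function\<close>

definition pohozaev :: "real \<Rightarrow> real" where
  "pohozaev t = (t * Q1 t)\<^sup>2 + 4 / 3 * (t * Q1 t) * Q t + 2 / 9 * (Q t)\<^sup>2 + t\<^sup>2 * (Q t ^ 4 / 2 - Q t ^ 2)"

text \<open>Completing the square, \<open>pohozaev t = (t Q' + 2 Q / 3)^2 - 2 Q^2 / 9 + t^2 (Q^4 / 2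
  - Q^2)\<close>, in essence an energy of \<open>t^(2/3) Q\<close>. The exponent 2/3 removes
  \<open>Q'\<close> and \<open>Q^4\<close> from the derivative, whose sign is then explicit.\<close>

lemma weighted_pohozaev_deriv:
  assumes "0 < t"
  shows "((\<lambda>t. t powr (2 / 3) * pohozaev t) has_real_derivative
           t powr (2 / 3) * (4 / 3 * (1 / (9 * t) - t) * (Q t)\<^sup>2)) (at t)"
proof -
  have tQ2: "t * Q2 t = t * Q t - t * Q t ^ 3 - 2 * Q1 t"
    using assms by (simp add: Q2_eq field_simps)
  have "(pohozaev has_real_derivative
      2 * (t * Q1 t) * (Q1 t + t * Q2 t) + 4 / 3 * ((Q1 t + t * Q2 t) * Q t + t * Q1 t * Q1 t)
      + 4 / 9 * Q t * Q1 t + 2 * t * (Q t ^ 4 / 2 - Q t ^ 2) + t\<^sup>2 * (2 * Q t ^ 3 * Q1 t - 2 * Q t * Q1 t)) (at t)"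
    unfolding pohozaev_def[abs_def]
    by (auto intro!: derivative_eq_intros Q_deriv assms simp: field_simps power2_eq_square)
  moreover have "2 * (t * Q1 t) * (Q1 t + t * Q2 t) + 4 / 3 * ((Q1 t + t * Q2 t) * Q t + t * Q1 t * Q1 t)
      + 4 / 9 * Q t * Q1 t + 2 * t * (Q t ^ 4 / 2 - Q t ^ 2) + t\<^sup>2 * (2 * Q t ^ 3 * Q1 t - 2 * Q t * Q1 t)
      = 4 / 3 * (1 / (9 * t) - t) * (Q t)\<^sup>2 - 2 / (3 * t) * pohozaev t"
    unfolding tQ2 pohozaev_def using assms by (simp add: divide_simps) algebra
  ultimately have P: "(pohozaev has_real_derivative
      4 / 3 * (1 / (9 * t) - t) * (Q t)\<^sup>2 - 2 / (3 * t) * pohozaev t) (at t)" by metis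
  have "((\<lambda>t. t powr (2 / 3)) has_real_derivative t powr (2 / 3) * (2 / (3 * t))) (at t)"
    using assms powr_diff[of t "2 / 3" 1] by (auto intro!: derivative_eq_intros)
  from DERIV_mult[OF this P] show ?thesis
    by (simp add: algebra_simps)
qed

lemma weighted_pohozaev_lim: "((\<lambda>t. t powr (2 / 3) * pohozaev t) \<longlongrightarrow> 0) at_top"
proof -
  obtain C where C: "0 < C" "\<forall>\<^sub>F t in at_top. 0 < u t \<and> u t \<le> C * exp (- t / 2) \<and> \<bar>u1 t\<bar> \<le> u t"
    using u_exp_bound by blast
  show ?thesis
  proof (rule Lim_null_comparison)
    show "((\<lambda>t. t powr (2 / 3) * (8 * (C * exp (- t / 2))\<^sup>2)) \<longlongrightarrow> 0) at_top"
      using C(1) by real_asymp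
    show "\<forall>\<^sub>F t in at_top. norm (t powr (2 / 3) * pohozaev t) \<le> t powr (2 / 3) * (8 * (C * exp (- t / 2))\<^sup>2)"
      using C(2) eventually_ge_at_top[of 1] Q_small[OF zero_less_one]
    proof eventually_elim
      case (elim t)
      have Q: "0 < Q t" "Q t < 1" using Q_pos elim by auto
      have Qu: "Q t \<le> u t" using elim Q by (simp add: u_def)
      have tQ1: "\<bar>t * Q1 t\<bar> \<le> 2 * u t" using elim Qu Q unfolding u1_def by linarith
      have "(t * Q1 t)\<^sup>2 \<le> (2 * u t)\<^sup>2" using tQ1 by (metis abs_ge_zero power2_abs power_mono)
      then have "(t * Q1 t)\<^sup>2 \<le> 4 * (u t)\<^sup>2" by (simp add: power_mult_distrib)
      moreover have "\<bar>4 / 3 * (t * Q1 t) * Q t\<bar> \<le> 8 / 3 * (u t)\<^sup>2"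
      proof -
        have "\<bar>4 / 3 * (t * Q1 t)\<bar> * \<bar>Q t\<bar> \<le> (4 / 3 * (2 * u t)) * u t"
          using tQ1 Qu Q by (intro mult_mono) auto
        then show ?thesis by (simp add: abs_mult power2_eq_square)
      qed
      moreover have "(Q t)\<^sup>2 \<le> (u t)\<^sup>2" using Qu Q by (intro power_mono) auto
      moreover have "\<bar>t\<^sup>2 * (Q t ^ 4 / 2 - Q t ^ 2)\<bar> \<le> (u t)\<^sup>2"
      proof -
        have "Q t ^ 4 \<le> Q t ^ 2" using Q by (intro power_decreasing) auto
        then have "\<bar>Q t ^ 4 / 2 - Q t ^ 2\<bar> \<le> Q t ^ 2" using zero_le_power[of "Q t" 4] Q(1) unfolding abs_le_iff by linarith
        then have "t\<^sup>2 * \<bar>Q t ^ 4 / 2 - Q t ^ 2\<bar> \<le> t\<^sup>2 * Q t ^ 2" by (intro mult_left_mono) auto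
        then show ?thesis by (simp add: abs_mult u_def power_mult_distrib)
      qed
      \<comment> \<open>The four bounds add up to \<open>4 + 8/3 + 2/9 + 1 < 8\<close>.\<close>
      ultimately have "\<bar>pohozaev t\<bar> \<le> 8 * (u t)\<^sup>2"
        unfolding pohozaev_def
        using zero_le_power2[of "t * Q1 t"] zero_le_power2[of "Q t"] by linarith
      also have "(u t)\<^sup>2 \<le> (C * exp (- t / 2))\<^sup>2" using elim by (intro power_mono) auto
      finally show ?case by (simp add: abs_mult mult_left_mono)
    qed
  qed
qed

text \<open>The weighted Pohozaev function vanishes at 0 and at infinity, and it increases up to
  \<open>t = 1/3\<close> and decreases from there on.\<close>

lemma pohozaev_nonneg:
  assumes t: "0 < t"
  shows "0 \<le> pohozaev t"
proof -
  let ?f = "\<lambda>t. t powr (2 / 3) * pohozaev t"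
  have "0 \<le> ?f t"
  proof (cases "t \<le> 1 / 3")
    case True
    have "?f 0 \<le> ?f t"
    proof (rule DERIV_nonneg_imp_increasing_open[of 0 t ?f])
      have "continuous_on {0..} ?f"
        unfolding pohozaev_def[abs_def] by (intro continuous_intros continuous_on_powr' Q_cont Q1_cont) auto
      then show "continuous_on {0..t} ?f" by (rule continuous_on_subset) auto
      fix s assume s: "0 < s" "s < t"
      have "0 \<le> 1 / (9 * s) - s"
        using s True mult_mono[of s "1 / 3" s "1 / 3"] by (simp add: field_simps)
      then have "0 \<le> s powr (2 / 3) * (4 / 3 * (1 / (9 * s) - s) * (Q s)\<^sup>2)" by simp
      then show "\<exists>y. (?f has_real_derivative y) (at s) \<and> 0 \<le> y"
        using weighted_pohozaev_deriv[OF s(1)] by blast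
    qed (use t in simp)
    then show ?thesis by simp
  next
    case False
    have "?f s \<le> ?f t" if "t \<le> s" for s
    proof (rule has_derivative_nonpos_imp_ge[of t s ?f, OF that weighted_pohozaev_deriv])
      fix r assume r: "r \<in> {t..s}"
      then show "0 < r" using t by simp
      have "1 / (9 * r) - r \<le> 0"
        using r False mult_mono[of "1 / 3" r "1 / 3" r] by (simp add: field_simps)
      then show "r powr (2 / 3) * (4 / 3 * (1 / (9 * r) - r) * (Q r)\<^sup>2) \<le> 0"
        by (simp add: mult_le_0_iff)
    qed
    then have "\<forall>\<^sub>F s in at_top. ?f s \<le> ?f t" by (rule eventually_at_top_linorderI)
    then show ?thesis
      using tendsto_upperbound[OF weighted_pohozaev_lim _ trivial_limit_at_top_linorder] by blast
  qed
  then show ?thesis using t by (simp add: zero_le_mult_iff)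
qed

end

section \<open>Barriers\<close>

text \<open>A barrier is a function \<open>p\<close> that plays the role of \<open>q = Q' / Q\<close>. Its potential \<open>P\<close> plays the role of \<open>Q\<^sup>2\<close>
  and is chosen such that the Riccati equation \<open>q' = 1 - Q\<^sup>2 - q\<^sup>2 - 2 q / t\<close> holds exactly; the residual
  \<open>P' - 2 p P\<close> measures how far \<open>p\<close> is from a solution. The barrier value is the Pohozaev function divided by
  \<open>(t Q)\<^sup>2\<close>, expressed through \<open>p\<close> and \<open>p'\<close>.\<close>

definition barrier_value :: "real \<Rightarrow> real \<Rightarrow> real \<Rightarrow> real" where
  "barrier_value t p p1 = p\<^sup>2 / 2 + p / (3 * t) - p1 / 2 + 2 / (9 * t\<^sup>2) - 1 / 2"

definition barrier_potential :: "real \<Rightarrow> real \<Rightarrow> real \<Rightarrow> real" where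
  "barrier_potential t p p1 = 1 - p1 - p\<^sup>2 - 2 * p / t"

definition barrier_residual :: "real \<Rightarrow> real \<Rightarrow> real \<Rightarrow> real \<Rightarrow> real" where
  "barrier_residual t p p1 p2 =
     - p2 - 2 * p * p1 - 2 * p1 / t + 2 * p / t\<^sup>2 - 2 * p * barrier_potential t p p1"

text \<open>For \<open>p = q\<close> this is the weighted Pohozaev identity divided by
  \<open>t^(8/3) Q^2\<close>, whose logarithmic derivative is \<open>8 / (3 * t) + 2 * q t\<close>.
  For general \<open>p\<close> the residual enters as a further source.\<close>

lemma barrier_value_deriv:
  assumes t: "t \<noteq> 0"
    and p: "(p has_real_derivative p1 t) (at t)" "(p1 has_real_derivative p2 t) (at t)"
  shows "((\<lambda>t. barrier_value t (p t) (p1 t)) has_real_derivative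
      - (8 / (3 * t) + 2 * p t) * barrier_value t (p t) (p1 t) + 4 / (3 * t) * (1 / (9 * t\<^sup>2) - 1)
      + barrier_residual t (p t) (p1 t) (p2 t) / 2) (at t)"
proof -
  have "((\<lambda>t. barrier_value t (p t) (p1 t)) has_real_derivative
      p t * p1 t + p1 t / (3 * t) - p t / (3 * t\<^sup>2) - p2 t / 2 - 4 / (9 * t ^ 3)) (at t)"
    unfolding barrier_value_def using t
    by (auto intro!: derivative_eq_intros p simp: field_simps power2_eq_square power3_eq_cube)
  moreover have "p t * p1 t + p1 t / (3 * t) - p t / (3 * t\<^sup>2) - p2 t / 2 - 4 / (9 * t ^ 3)
    = - (8 / (3 * t) + 2 * p t) * barrier_value t (p t) (p1 t) + 4 / (3 * t) * (1 / (9 * t\<^sup>2) - 1)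
      + barrier_residual t (p t) (p1 t) (p2 t) / 2"
    unfolding barrier_value_def barrier_residual_def barrier_potential_def
    using t by (simp add: divide_simps) algebra
  ultimately show ?thesis by simp
qed

section \<open>The Riccati equation and backward comparison\<close>

context ground_state begin

definition q :: "real \<Rightarrow> real" where "q t = Q1 t / Q t"
definition q1 :: "real \<Rightarrow> real" where "q1 t = 1 - (Q t)\<^sup>2 - (q t)\<^sup>2 - 2 * q t / t"
definition q2 :: "real \<Rightarrow> real" where
  "q2 t = - 2 * q t * (Q t)\<^sup>2 - 2 * q t * q1 t - 2 * q1 t / t + 2 * q t / t\<^sup>2"

lemma q_deriv: "0 < t \<Longrightarrow> (q has_real_derivative q1 t) (at t)"
  unfolding q_def[abs_def] q1_def using Q_pos[of t]
  by (auto intro!: derivative_eq_intros Q_deriv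
      simp: Q2_eq field_simps power2_eq_square power3_eq_cube)

lemma q1_deriv:
  assumes "0 < t"
  shows "(q1 has_real_derivative q2 t) (at t)"
proof -
  have "Q1 t = q t * Q t" using Q_pos[of t] assms by (simp add: q_def)
  then show ?thesis
    unfolding q1_def[abs_def] q2_def using assms
    by (auto intro!: derivative_eq_intros Q_deriv q_deriv simp: q1_def field_simps power2_eq_square)
qed

lemma barrier_residual_q: "0 < t \<Longrightarrow> barrier_residual t (q t) (q1 t) (q2 t) = 0"
  by (simp add: barrier_residual_def barrier_potential_def q2_def q1_def)

lemma barrier_value_q_nonneg:
  assumes "0 < t"
  shows "0 \<le> barrier_value t (q t) (q1 t)"
proof -
  have "pohozaev t = (t * Q t)\<^sup>2 * barrier_value t (q t) (q1 t)"
    unfolding pohozaev_def barrier_value_def q1_def q_def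
    using assms Q_pos[of t] by (simp add: divide_simps) algebra
  then show ?thesis
    using pohozaev_nonneg[OF assms] assms Q_pos[of t] by (simp add: zero_le_mult_iff)
qed

definition above :: "(real \<Rightarrow> real) \<Rightarrow> (real \<Rightarrow> real) \<Rightarrow> real \<Rightarrow> bool" where
  "above p p1 t \<longleftrightarrow> p t < q t \<and> barrier_value t (p t) (p1 t) < barrier_value t (q t) (q1 t)"

text \<open>Solving \<open>barrier_value\<close> for the slope gives
  \<open>p' = p^2 + 2 p / (3 t) + 4 / (9 t^2) - 1 - 2 H\<close> with the value \<open>H\<close>;
  subtract this from the same formula for \<open>q\<close>.\<close>

lemma slope_gap_deriv:
  assumes "0 < t" "(p has_real_derivative p1 t) (at t)"
  shows "((\<lambda>t. q t - p t) has_real_derivative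
      (q t + p t + 2 / (3 * t)) * (q t - p t)
      - 2 * (barrier_value t (q t) (q1 t) - barrier_value t (p t) (p1 t))) (at t)"
  by (rule DERIV_cong[OF DERIV_diff[OF q_deriv assms(2)]])
    (use assms in \<open>simp_all add: barrier_value_def field_simps power2_eq_square\<close>)

text \<open>The explicit source is common to \<open>q\<close> and \<open>p\<close> and cancels. The
  products are split so that the slope gap is multiplied by the value of \<open>q\<close>, which is
  nonnegative.\<close>

lemma value_gap_deriv:
  assumes "0 < t" "(p has_real_derivative p1 t) (at t)" "(p1 has_real_derivative p2 t) (at t)"
  shows "((\<lambda>t. barrier_value t (q t) (q1 t) - barrier_value t (p t) (p1 t)) has_real_derivative
      - (8 / (3 * t) + 2 * p t) * (barrier_value t (q t) (q1 t) - barrier_value t (p t) (p1 t))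
      - 2 * barrier_value t (q t) (q1 t) * (q t - p t)
      - barrier_residual t (p t) (p1 t) (p2 t) / 2) (at t)"
  by (rule DERIV_cong[OF DERIV_diff[OF barrier_value_deriv[of t q q1 q2] barrier_value_deriv[of t p p1 p2]]])
    (use assms in \<open>simp_all add: q_deriv q1_deriv barrier_residual_q algebra_simps\<close>)

text \<open>The gaps of slope and value solve a linear system that is cooperative in the direction of decreasing \<open>t\<close>,
  because the Pohozaev function is nonnegative.\<close>

lemma above_backward:
  assumes ab: "0 < a" "a \<le> b"
    and p: "\<And>t. t \<in> {a..b} \<Longrightarrow> (p has_real_derivative p1 t) (at t)"
    and p1: "\<And>t. t \<in> {a..b} \<Longrightarrow> (p1 has_real_derivative p2 t) (at t)"
    and res: "\<And>t. t \<in> {a<..<b} \<Longrightarrow> 0 \<le> barrier_residual t (p t) (p1 t) (p2 t)"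
    and b: "above p p1 b"
  shows "above p p1 a"
proof -
  have pos: "0 < t" if "t \<in> {a..b}" for t using that ab by simp
  have cont: "continuous_on {a..b} p" "continuous_on {a..b} q"
    by (auto intro!: continuous_at_imp_continuous_on DERIV_isCont[OF p] DERIV_isCont[OF q_deriv] pos)
  have "0 < q a - p a \<and> 0 < barrier_value a (q a) (q1 a) - barrier_value a (p a) (p1 a)"
  proof (rule positive_quadrant_backward_invariant[
        where x = "\<lambda>t. q t - p t" and y = "\<lambda>t. barrier_value t (q t) (q1 t) - barrier_value t (p t) (p1 t)"
          and \<mu> = "\<lambda>_. 2" and \<nu> = "\<lambda>t. 2 * barrier_value t (q t) (q1 t)"
          and \<alpha> = "\<lambda>t. q t + p t + 2 / (3 * t)" and \<beta> = "\<lambda>t. - (8 / (3 * t) + 2 * p t)",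
        OF ab(2) slope_gap_deriv[of _ p p1] value_gap_deriv[of _ p p1 p2]])
    show "- (8 / (3 * t) + 2 * p t) * (barrier_value t (q t) (q1 t) - barrier_value t (p t) (p1 t))
      - 2 * barrier_value t (q t) (q1 t) * (q t - p t) - barrier_residual t (p t) (p1 t) (p2 t) / 2
      \<le> - (8 / (3 * t) + 2 * p t) * (barrier_value t (q t) (q1 t) - barrier_value t (p t) (p1 t))
      - 2 * barrier_value t (q t) (q1 t) * (q t - p t)" if "t \<in> {a<..<b}" for t
      using res[OF that] by simp
    show "0 \<le> 2 * barrier_value t (q t) (q1 t)" if "t \<in> {a<..<b}" for t
      using barrier_value_q_nonneg[of t] pos[of t] that by simp
    show "continuous_on {a..b} (\<lambda>t. q t + p t + 2 / (3 * t))"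
      "continuous_on {a..b} (\<lambda>t. - (8 / (3 * t) + 2 * p t))"
      using ab by (auto intro!: continuous_intros cont)
    show "0 < q b - p b" "0 < barrier_value b (q b) (q1 b) - barrier_value b (p b) (p1 b)"
      using b by (auto simp: above_def)
  qed (use pos p p1 in simp_all)
  then show ?thesis by (simp add: above_def)
qed

section \<open>Comparison at infinity\<close>

lemma q_lim: "(q \<longlongrightarrow> - 1) at_top"
proof -
  have y: "q t = u1 t / u t - 1 / t" if "0 < t" for t
    using that Q_pos[of t] by (simp add: q_def u1_def u_def field_simps)
  have "((\<lambda>t. u1 t / u t) \<longlongrightarrow> - 1) at_top"
  proof (rule order_tendstoI)
    fix c :: real assume "c < - 1"
    show "\<forall>\<^sub>F t in at_top. c < u1 t / u t"
      using eventually_gt_at_top[of 0]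
    proof eventually_elim
      case (elim t)
      have "- 1 < u1 t / u t" using u_plus_u1_pos[OF elim] u_pos[OF elim] by (simp add: field_simps)
      then show ?case using \<open>c < - 1\<close> by simp
    qed
  next
    fix c :: real assume c: "- 1 < c"
    \<comment> \<open>The midpoint of \<open>- c\<close> and 1, kept away from 0 when
      \<open>c\<close> is large.\<close>
    define l where "l = max (1 / 2) ((1 - c) / 2)"
    have l: "0 < l" "l < 1" "- l < c" using c by (auto simp: l_def max_def field_simps)
    show "\<forall>\<^sub>F t in at_top. u1 t / u t < c"
      using eventually_gt_at_top[of 0] u1_le[OF l(1,2)]
    proof eventually_elim
      case (elim t)
      have "u1 t / u t \<le> - l" using elim u_pos[of t] by (simp add: field_simps)
      then show ?case using l by simp
    qed
  qed
  moreover have "((\<lambda>t::real. 1 / t) \<longlongrightarrow> 0) at_top" by real_asymp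
  ultimately have "((\<lambda>t. u1 t / u t - 1 / t) \<longlongrightarrow> - 1 - 0) at_top"
    by (rule tendsto_diff)
  moreover have "\<forall>\<^sub>F t in at_top. u1 t / u t - 1 / t = q t"
    using eventually_gt_at_top[of 0] by eventually_elim (simp add: y)
  ultimately show ?thesis by (simp add: tendsto_cong)
qed

text \<open>Both gaps tend to 0, so it suffices that each decreases strictly wherever it is
  nonpositive. For the slope gap this follows from the potential lying below \<open>Q^2\<close>, for
  the value gap from the positive residual and the positive slope gap.\<close>

lemma eventually_above:
  assumes p: "\<And>t. T \<le> t \<Longrightarrow> (p has_real_derivative p1 t) (at t)"
    and p1: "\<And>t. T \<le> t \<Longrightarrow> (p1 has_real_derivative p2 t) (at t)"
    and res: "\<And>t. T \<le> t \<Longrightarrow> 0 < barrier_residual t (p t) (p1 t) (p2 t)"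
    and pot: "\<And>t. T \<le> t \<Longrightarrow> barrier_potential t (p t) (p1 t) < (Q t)\<^sup>2"
    and lim: "(p \<longlongrightarrow> - 1) at_top" "(p1 \<longlongrightarrow> 0) at_top"
  shows "\<forall>\<^sub>F t in at_top. above p p1 t"
proof -
  have inv: "((\<lambda>t::real. c / t) \<longlongrightarrow> 0) at_top" for c :: real by real_asymp
  have inv2: "((\<lambda>t::real. c / t\<^sup>2) \<longlongrightarrow> 0) at_top" for c :: real by real_asymp
  have "((\<lambda>t. q t + p t + 2 / t) \<longlongrightarrow> - 1 + - 1 + 0) at_top"
    by (intro tendsto_add q_lim lim inv)
  then have e1: "\<forall>\<^sub>F t in at_top. q t + p t + 2 / t < 0" by (rule order_tendstoD) simp
  have "((\<lambda>t. (8 / 3) / t + 2 * p t) \<longlongrightarrow> 0 + 2 * - 1) at_top"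
    by (intro tendsto_add tendsto_mult tendsto_const lim inv)
  then have e2: "\<forall>\<^sub>F t in at_top. (8 / 3) / t + 2 * p t < 0" by (rule order_tendstoD) simp
  have "\<forall>\<^sub>F t in at_top. T \<le> t \<and> 0 < t \<and> q t + p t + 2 / t < 0 \<and> (8 / 3) / t + 2 * p t < 0"
    using e1 e2 eventually_ge_at_top[of T] eventually_gt_at_top[of 0] by eventually_elim auto
  then obtain s where s: "\<And>t. s \<le> t \<Longrightarrow>
      T \<le> t \<and> 0 < t \<and> q t + p t + 2 / t < 0 \<and> (8 / 3) / t + 2 * p t < 0"
    by (auto simp: eventually_at_top_linorder)
  have xpos: "0 < q r - p r" if r: "s \<le> r" for r
  proof (rule positive_if_tendsto_0[where f = "\<lambda>t. q t - p t"])
    show "((\<lambda>t. q t - p t) has_real_derivative q1 t - p1 t) (at t)" if "r \<le> t" for t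
      using s[of t] that r by (intro DERIV_diff q_deriv p) auto
    show "q1 t - p1 t < 0" if t: "r \<le> t" "q t - p t \<le> 0" for t
    proof -
      have st: "T \<le> t" "0 < t" "q t + p t + 2 / t < 0" using s[of t] t r by auto
      have "q1 t - p1 t = (barrier_potential t (p t) (p1 t) - (Q t)\<^sup>2) - (q t + p t + 2 / t) * (q t - p t)"
        using st by (simp add: q1_def barrier_potential_def field_simps power2_eq_square)
      moreover have "0 \<le> (q t + p t + 2 / t) * (q t - p t)"
        using st t by (intro mult_nonpos_nonpos) auto
      ultimately show ?thesis using pot[OF st(1)] by linarith
    qed
    show "((\<lambda>t. q t - p t) \<longlongrightarrow> 0) at_top" using tendsto_diff[OF q_lim lim(1)] by simp
  qed
  have ypos: "0 < barrier_value r (q r) (q1 r) - barrier_value r (p r) (p1 r)" if r: "s \<le> r" for r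
  proof (rule positive_if_tendsto_0[
        where f = "\<lambda>t. barrier_value t (q t) (q1 t) - barrier_value t (p t) (p1 t)", OF value_gap_deriv])
    show "0 < t" "(p has_real_derivative p1 t) (at t)" "(p1 has_real_derivative p2 t) (at t)"
      if "r \<le> t" for t using s[of t] that r p p1 by auto
    show "- (8 / (3 * t) + 2 * p t) * (barrier_value t (q t) (q1 t) - barrier_value t (p t) (p1 t))
      - 2 * barrier_value t (q t) (q1 t) * (q t - p t)
      - barrier_residual t (p t) (p1 t) (p2 t) / 2 < 0"
      if t: "r \<le> t" "barrier_value t (q t) (q1 t) - barrier_value t (p t) (p1 t) \<le> 0" for t
    proof -
      have st: "T \<le> t" "0 < t" "8 / (3 * t) + 2 * p t < 0" using s[of t] t r by auto
      have "0 \<le> (8 / (3 * t) + 2 * p t) * (barrier_value t (q t) (q1 t) - barrier_value t (p t) (p1 t))"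
        using st t by (intro mult_nonpos_nonpos) auto
      moreover have "0 \<le> barrier_value t (q t) (q1 t) * (q t - p t)"
        using barrier_value_q_nonneg[OF st(2)] xpos[of t] t r by (intro mult_nonneg_nonneg) auto
      ultimately show ?thesis using res[OF st(1)] unfolding mult_minus_left mult.assoc by linarith
    qed
    have q1_lim: "(q1 \<longlongrightarrow> 0) at_top"
    proof -
      have "((\<lambda>t. 1 - (Q t)\<^sup>2 - (q t)\<^sup>2 - q t * (2 / t)) \<longlongrightarrow> 1 - 0\<^sup>2 - (- 1)\<^sup>2 - (- 1) * 0) at_top"
        by (intro tendsto_diff tendsto_mult tendsto_power tendsto_const Q_lim q_lim inv)
      then show ?thesis by (simp add: q1_def[abs_def] mult.commute)
    qed
    have bv: "((\<lambda>t. barrier_value t (g t) (g1 t)) \<longlongrightarrow> 0) at_top"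
      if "(g \<longlongrightarrow> - 1) at_top" "(g1 \<longlongrightarrow> 0) at_top" for g g1
    proof -
      have "((\<lambda>t. (g t)\<^sup>2 / 2 + g t * ((1 / 3) / t) - g1 t / 2 + (2 / 9) / t\<^sup>2 - 1 / 2)
        \<longlongrightarrow> (- 1)\<^sup>2 / 2 + (- 1) * 0 - 0 / 2 + 0 - 1 / 2) at_top"
        by (intro tendsto_diff tendsto_add tendsto_mult tendsto_divide tendsto_power tendsto_const that inv inv2) simp_all
      then show ?thesis by (simp add: barrier_value_def)
    qed
    show "((\<lambda>t. barrier_value t (q t) (q1 t) - barrier_value t (p t) (p1 t)) \<longlongrightarrow> 0) at_top"
      using tendsto_diff[OF bv[OF q_lim q1_lim] bv[OF lim]] by simp
  qed
  show ?thesis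
    using xpos ypos by (auto intro!: eventually_at_top_linorderI[of s] simp: above_def)
qed

end

section \<open>Integer polynomials\<close>

primrec ev :: "int list \<Rightarrow> real \<Rightarrow> real" where
  "ev [] x = 0"
| "ev (c # p) x = of_int c + x * ev p x"

fun padd :: "int list \<Rightarrow> int list \<Rightarrow> int list" where
  "padd [] q = q"
| "padd p [] = p"
| "padd (a # p) (b # q) = (a + b) # padd p q"

definition pscale :: "int \<Rightarrow> int list \<Rightarrow> int list" where
  "pscale k p = map (\<lambda>c. k * c) p"

primrec pmul :: "int list \<Rightarrow> int list \<Rightarrow> int list" where
  "pmul [] q = []"
| "pmul (a # p) q = padd (pscale a q) (0 # pmul p q)"

primrec pder :: "int list \<Rightarrow> int list" where
  "pder [] = []"
| "pder (c # p) = padd p (0 # pder p)"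

primrec one_plus_power :: "nat \<Rightarrow> int list" where
  "one_plus_power 0 = [1]"
| "one_plus_power (Suc n) = pmul [1, 1] (one_plus_power n)"

text \<open>The coefficients of \<open>(1 + w)\<^sup>n p(1 / (1 + w))\<close>, where \<open>n\<close> is the formal degree: up to binomial factors
  these are the Bernstein coefficients of \<open>p\<close> on the unit interval.\<close>

primrec moebius :: "int list \<Rightarrow> int list" where
  "moebius [] = []"
| "moebius (a # p) = padd (pscale a (one_plus_power (length p))) (moebius p)"

lemma ev_padd [simp]: "ev (padd p q) x = ev p x + ev q x"
  by (induction p q rule: padd.induct) (auto simp: algebra_simps)

lemma ev_pscale [simp]: "ev (pscale k p) x = of_int k * ev p x"
  unfolding pscale_def by (induction p) (auto simp: algebra_simps)

lemma ev_pmul [simp]: "ev (pmul p q) x = ev p x * ev q x"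
  by (induction p) (auto simp: algebra_simps)

lemma ev_has_derivative: "(ev p has_real_derivative ev (pder p) x) (at x)"
proof (induction p)
  case Nil
  show ?case by (simp add: ev.simps(1)[abs_def])
next
  case (Cons c p)
  have "ev (c # p) = (\<lambda>x. of_int c + x * ev p x)" by auto
  then show ?case
    by (auto intro!: derivative_eq_intros Cons)
qed

lemma ev_one_plus_power [simp]: "ev (one_plus_power n) w = (1 + w) ^ n"
  by (induction n) (auto simp: algebra_simps)

lemma ev_nonneg: "\<lbrakk>list_all (\<lambda>c. 0 \<le> c) p; 0 \<le> x\<rbrakk> \<Longrightarrow> 0 \<le> ev p x"
  by (induction p) auto

text \<open>\<open>length p\<close> is the formal degree plus one, hence the extra factor
  \<open>x\<close>.\<close>

lemma ev_moebius:
  assumes "x \<noteq> 0"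
  shows "x * ev p x = x ^ length p * ev (moebius p) (1 / x - 1)"
proof (induction p)
  case (Cons c p)
  have "x ^ length (c # p) * ev (moebius (c # p)) (1 / x - 1)
      = x * (of_int c * (x ^ length p * (1 / x) ^ length p)) + x * (x ^ length p * ev (moebius p) (1 / x - 1))"
    by (simp add: algebra_simps)
  also have "x ^ length p * (1 / x) ^ length p = 1"
    using assms by (simp add: power_divide)
  also have "x ^ length p * ev (moebius p) (1 / x - 1) = x * ev p x"
    using Cons by simp
  finally show ?case by (simp add: algebra_simps)
qed simp

lemma ev_nonneg_unit_interval:
  assumes "list_all (\<lambda>c. 0 \<le> c) (moebius p)" and x: "0 < x" "x \<le> 1"
  shows "0 \<le> ev p x"
proof -
  have "0 \<le> ev (moebius p) (1 / x - 1)"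
    using ev_nonneg[OF assms(1)] x by simp
  then have "0 \<le> x * ev p x"
    using ev_moebius[of x p] x by simp
  then show ?thesis using x by (simp add: zero_le_mult_iff)
qed

text \<open>With \<open>t = (a + n x) / 100\<close> and \<open>z = zs(x) / 10\<^sup>1\<^sup>2\<close>, the first list represents
  \<open>10\<^sup>3\<^sup>2 n (t\<^sup>4 - t\<^sup>2 z' - z\<^sup>2)\<close> and the last one \<open>10\<^sup>4\<^sup>6 n\<^sup>2 t\<^sup>6\<close> times the residual of the barrier \<open>z / t\<^sup>2\<close>.
  Intermediate lists are passed as arguments so that rewriting evaluates them only once.\<close>

definition barrier_gap :: "int \<Rightarrow> int list \<Rightarrow> int list \<Rightarrow> int list" where
  "barrier_gap n t2 zs =
     padd (pscale (n * 10 ^ 24) (pmul t2 t2))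
       (padd (pscale (- (10 ^ 18)) (pmul t2 (pder zs))) (pscale (- (n * 10 ^ 8)) (pmul zs zs)))"

definition barrier_defect' :: "int \<Rightarrow> int list \<Rightarrow> int list \<Rightarrow> int list \<Rightarrow> int list \<Rightarrow> int list" where
  "barrier_defect' n t t2 zs m =
     padd (pscale (10 ^ 12) (pmul t2 (pder m)))
       (pscale (- n) (pmul (padd (pscale (4 * 10 ^ 12) t) (pscale 200 zs)) m))"

definition barrier_defect :: "int \<Rightarrow> int \<Rightarrow> int list \<Rightarrow> int list" where
  "barrier_defect a n zs =
     barrier_defect' n [a, n] (pmul [a, n] [a, n]) zs (barrier_gap n (pmul [a, n] [a, n]) zs)"

text \<open>The coefficients interpolate a numerical solution for \<open>t\<^sup>2 Q' / Q\<close> that continues the tail barrier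
  below backwards from \<open>t = 4\<close>, with \<open>P'\<close> increased by a small multiple of \<open>P\<close>
  to leave room for the interpolation error. The k-th list is used on the k-th of the intervals
  [2.4, 4], [1.3, 2.4], [0.6, 1.3], [0.2, 0.6], [0.03, 0.2], [0.01, 0.03].\<close>

definition barrier_1 :: "int list" where
  "barrier_1 =
    [- 8147306432739, - 9319294852585, - 2500015618280, - 59595227557, 42418931677,
     - 21909644738, 7376217281, - 657524726, - 844748977, 466154594, - 85171187]"

definition barrier_2 :: "int list" where
  "barrier_2 =
    [- 2889702744507, - 4155143132004, - 1044239075906, - 53257434942, - 48076122860,
     94678930788, - 92242825873, 63403612781, - 30832346609, 9467764444, - 1363058051]"

definition barrier_3 :: "int list" where
  "barrier_3 =
    [- 683596607756, - 1687160757530, - 721032063620, 393220466220, - 253616850427, 78699509,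
     172336922787, - 192886436199, 117119128534, - 40342124846, 6176878821]"

definition barrier_4 :: "int list" where
  "barrier_4 =
    [- 43056938560, - 242586667725, - 412116892201, - 106487079646, 181456587970,
     - 34975049503, - 68194699611, 61783601970, - 22600262301, 3078189823, 102602028]"

definition barrier_5 :: "int list" where
  "barrier_5 =
    [- 144587454, - 2710493684, - 15310665678, - 28497054212, 1882723626, 2049436224,
     - 188316233, - 178645887, 37156291, 5317717, - 1809270]"

definition barrier_6 :: "int list" where
  "barrier_6 =
    [9089898, - 35489805, - 70935843, - 47460404, 179275, 29425]"

text \<open>Exact integer certificates: nonnegative transformed coefficients make the residual of
  each polynomial barrier nonnegative on its interval.\<close>

lemma barrier_1_defect: "list_all (\<lambda>c. 0 \<le> c) (moebius (barrier_defect 240 160 barrier_1))"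
  by code_simp

lemma barrier_2_defect: "list_all (\<lambda>c. 0 \<le> c) (moebius (barrier_defect 130 110 barrier_2))"
  by code_simp

lemma barrier_3_defect: "list_all (\<lambda>c. 0 \<le> c) (moebius (barrier_defect 60 70 barrier_3))"
  by code_simp

lemma barrier_4_defect: "list_all (\<lambda>c. 0 \<le> c) (moebius (barrier_defect 20 40 barrier_4))"
  by code_simp

lemma barrier_5_defect: "list_all (\<lambda>c. 0 \<le> c) (moebius (barrier_defect 3 17 barrier_5))"
  by code_simp

lemma barrier_6_defect: "list_all (\<lambda>c. 0 \<le> c) (moebius (barrier_defect 1 2 barrier_6))"
  by code_simp

section \<open>Piecewise polynomial barriers\<close>

lemma quotient_power_deriv:
  fixes t :: real
  assumes "t \<noteq> 0" and z: "(z has_real_derivative z') (at t)"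
  shows "((\<lambda>t. z t / t ^ n) has_real_derivative z' / t ^ n - n * z t / t ^ Suc n) (at t)"
proof (cases n)
  case (Suc m)
  have "((\<lambda>t. z t / t ^ n) has_real_derivative
      (z' * t ^ n - z t * (n * t ^ m)) / (t ^ n * t ^ n)) (at t)"
    using DERIV_divide[OF z DERIV_pow[of n t]] assms(1) Suc by simp
  moreover have "(z' * t ^ n - z t * (n * t ^ m)) / (t ^ n * t ^ n) = z' / t ^ n - n * z t / t ^ Suc n"
    using assms(1) unfolding Suc by (simp add: field_simps)
  ultimately show ?thesis by simp
qed (use z in simp)

text \<open>A polynomial \<open>z\<close> for \<open>t\<^sup>2 Q' / Q\<close> yields the barrier \<open>z / t\<^sup>2\<close>, and this substitution turns the
  residual into a polynomial.\<close>

lemma residual_of_quotient: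
  fixes t z z' z'' :: real
  assumes "t \<noteq> 0"
  shows "barrier_residual t (z / t ^ 2) (z' / t ^ 2 - 2 * z / t ^ 3) (z'' / t ^ 2 - 4 * z' / t ^ 3 + 6 * z / t ^ 4)
    = (t\<^sup>2 * (4 * t ^ 3 - 2 * t * z' - t\<^sup>2 * z'' - 2 * z * z') - (4 * t + 2 * z) * (t ^ 4 - t\<^sup>2 * z' - z\<^sup>2)) / t ^ 6"
  unfolding barrier_residual_def barrier_potential_def
  using assms by (simp add: divide_simps) algebra

definition flux :: "int \<Rightarrow> int \<Rightarrow> int list \<Rightarrow> real \<Rightarrow> real" where
  "flux a n zs t = ev zs ((100 * t - a) / n) / 10 ^ 12"

definition flux1 :: "int \<Rightarrow> int \<Rightarrow> int list \<Rightarrow> real \<Rightarrow> real" where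
  "flux1 a n zs t = ev (pder zs) ((100 * t - a) / n) * (100 / n) / 10 ^ 12"

definition flux2 :: "int \<Rightarrow> int \<Rightarrow> int list \<Rightarrow> real \<Rightarrow> real" where
  "flux2 a n zs t = ev (pder (pder zs)) ((100 * t - a) / n) * (100 / n) * (100 / n) / 10 ^ 12"

definition piece :: "int \<Rightarrow> int \<Rightarrow> int list \<Rightarrow> real \<Rightarrow> real" where
  "piece a n zs t = flux a n zs t / t ^ 2"

definition piece1 :: "int \<Rightarrow> int \<Rightarrow> int list \<Rightarrow> real \<Rightarrow> real" where
  "piece1 a n zs t = flux1 a n zs t / t ^ 2 - 2 * flux a n zs t / t ^ 3"

definition piece2 :: "int \<Rightarrow> int \<Rightarrow> int list \<Rightarrow> real \<Rightarrow> real" where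
  "piece2 a n zs t = flux2 a n zs t / t ^ 2 - 4 * flux1 a n zs t / t ^ 3 + 6 * flux a n zs t / t ^ 4"

lemma ev_affine_deriv:
  assumes "n \<noteq> 0"
  shows "((\<lambda>t. ev p ((100 * t - real_of_int a) / real_of_int n)) has_real_derivative
    ev (pder p) ((100 * t - a) / n) * (100 / n)) (at t)"
  by (rule DERIV_chain2[OF ev_has_derivative]) (use assms in \<open>auto intro!: derivative_eq_intros\<close>)

lemma flux_deriv: "n \<noteq> 0 \<Longrightarrow> (flux a n zs has_real_derivative flux1 a n zs t) (at t)"
  unfolding flux_def[abs_def] flux1_def by (intro DERIV_cdivide ev_affine_deriv)

lemma flux1_deriv: "n \<noteq> 0 \<Longrightarrow> (flux1 a n zs has_real_derivative flux2 a n zs t) (at t)"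
  unfolding flux1_def[abs_def] flux2_def by (intro DERIV_cdivide DERIV_cmult_right ev_affine_deriv)

lemma piece_deriv:
  assumes "n \<noteq> 0" "t \<noteq> 0"
  shows "(piece a n zs has_real_derivative piece1 a n zs t) (at t)"
  unfolding piece_def[abs_def] piece1_def
  using quotient_power_deriv[OF assms(2) flux_deriv[OF assms(1)], of a zs 2] by simp

lemma piece1_deriv:
  assumes "n \<noteq> 0" "t \<noteq> 0"
  shows "(piece1 a n zs has_real_derivative piece2 a n zs t) (at t)"
  unfolding piece1_def[abs_def] piece2_def
  by (rule DERIV_cong[OF DERIV_diff[OF quotient_power_deriv[OF assms(2) flux1_deriv[OF assms(1)], of a zs 2]
          quotient_power_deriv[OF assms(2) DERIV_cmult[OF flux_deriv[OF assms(1)]], of 2 a zs 3]]])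
    simp

lemma ev_barrier_defect:
  fixes x \<tau> z z' z'' :: real and a n :: int and zs :: "int list"
  defines "\<tau> \<equiv> a + n * x" and "z \<equiv> ev zs x" and "z' \<equiv> ev (pder zs) x" and "z'' \<equiv> ev (pder (pder zs)) x"
  shows "ev (barrier_defect a n zs) x =
    10 ^ 12 * \<tau>\<^sup>2 * (4 * n\<^sup>2 * 10 ^ 24 * \<tau> ^ 3 - 10 ^ 18 * (2 * n * \<tau> * z' + \<tau>\<^sup>2 * z'') - 2 * n * 10 ^ 8 * z * z')
    - n * (4 * 10 ^ 12 * \<tau> + 200 * z) * (n * 10 ^ 24 * \<tau> ^ 4 - 10 ^ 18 * \<tau>\<^sup>2 * z' - n * 10 ^ 8 * z\<^sup>2)"
proof -
  define t2 where "t2 = pmul [a, n] [a, n]"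
  define m where "m = barrier_gap n t2 zs"
  have t2: "ev t2 y = (a + n * y)\<^sup>2" for y :: real by (simp add: t2_def power2_eq_square algebra_simps)
  have m: "ev m = (\<lambda>y :: real. n * 10 ^ 24 * (a + n * y) ^ 4 - 10 ^ 18 * (a + n * y)\<^sup>2 * ev (pder zs) y
      - n * 10 ^ 8 * (ev zs y)\<^sup>2)"
    by (rule ext) (simp add: m_def barrier_gap_def t2 power2_eq_square power4_eq_xxxx algebra_simps)
  define D where "D = 4 * n\<^sup>2 * 10 ^ 24 * \<tau> ^ 3 - 10 ^ 18 * (2 * n * \<tau> * z' + \<tau>\<^sup>2 * z'') - 2 * n * 10 ^ 8 * z * z'"
  have "(ev m has_real_derivative D) (at x)"
    unfolding D_def \<tau>_def z_def z'_def z''_def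
    by (rule ssubst[OF m, where P = "\<lambda>f. (f has_real_derivative _) (at x)"])
      (auto intro!: derivative_eq_intros ev_has_derivative simp: power2_eq_square algebra_simps)
  then have "ev (pder m) x = D"
    by (rule DERIV_unique[OF ev_has_derivative])
  then have "ev (barrier_defect a n zs) x = 10 ^ 12 * (a + n * x)\<^sup>2 * D - n * (4 * 10 ^ 12 * \<tau> + 200 * z) * ev m x"
    unfolding barrier_defect_def t2_def[symmetric] m_def[symmetric] barrier_defect'_def
    by (simp add: t2 \<tau>_def z_def algebra_simps)
  also have "ev m x = n * 10 ^ 24 * \<tau> ^ 4 - 10 ^ 18 * \<tau>\<^sup>2 * z' - n * 10 ^ 8 * z\<^sup>2"
    by (simp add: m \<tau>_def z_def z'_def)
  finally show ?thesis by (simp add: D_def \<tau>_def)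
qed

lemma piece_residual:
  fixes a n :: int and t :: real
  assumes "0 < n" "0 < t"
  shows "barrier_residual t (piece a n zs t) (piece1 a n zs t) (piece2 a n zs t)
    = ev (barrier_defect a n zs) ((100 * t - a) / n) / (n\<^sup>2 * 10 ^ 46 * t ^ 6)"
proof -
  define x where "x = (100 * t - a) / n"
  have \<tau>: "a + n * x = 100 * t" using assms by (simp add: x_def)
  define z z' z'' where "z = flux a n zs t" and "z' = flux1 a n zs t" and "z'' = flux2 a n zs t"
  have ev: "ev zs x = 10 ^ 12 * z" "ev (pder zs) x = n * 10 ^ 10 * z'"
    "ev (pder (pder zs)) x = n * n * 10 ^ 8 * z''"
    using assms by (simp_all add: z_def z'_def z''_def flux_def flux1_def flux2_def x_def)
  have "ev (barrier_defect a n zs) x = (n\<^sup>2 * 10 ^ 46)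
    * (t\<^sup>2 * (4 * t ^ 3 - 2 * t * z' - t\<^sup>2 * z'' - 2 * z * z') - (4 * t + 2 * z) * (t ^ 4 - t\<^sup>2 * z' - z\<^sup>2))"
    unfolding ev_barrier_defect \<tau> ev by (simp add: algebra_simps eval_nat_numeral)
  then show ?thesis
    unfolding x_def[symmetric] piece_def piece1_def piece2_def
      z_def[symmetric] z'_def[symmetric] z''_def[symmetric]
    using assms by (subst residual_of_quotient) simp_all
qed

context ground_state begin

lemma above_piece_backward:
  fixes a n :: int
  assumes an: "0 < a" "0 < n"
    and defect: "list_all (\<lambda>c. 0 \<le> c) (moebius (barrier_defect a n zs))"
    and above: "above (piece a n zs) (piece1 a n zs) ((a + n) / 100)"
  shows "above (piece a n zs) (piece1 a n zs) (a / 100)"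
proof (rule above_backward[OF _ _ piece_deriv piece1_deriv _ above])
  fix t assume t: "t \<in> {real_of_int a / 100<..<(a + n) / 100}"
  have "0 < real_of_int a / 100" using an by simp
  then have t0: "0 < t" using t by simp
  have "0 < (100 * t - a) / n" "(100 * t - a) / n \<le> 1" using t an by (simp_all add: field_simps)
  then have "0 \<le> ev (barrier_defect a n zs) ((100 * t - a) / n)"
    by (rule ev_nonneg_unit_interval[OF defect])
  then show "0 \<le> barrier_residual t (piece a n zs t) (piece1 a n zs t) (piece2 a n zs t)"
    using piece_residual[OF an(2) t0] t0 by simp
qed (use an in \<open>auto intro: less_le_trans[rotated]\<close>)

text \<open>Adjacent pieces agree at the knot, but the slope may jump. Since \<open>p1\<close>
  enters \<open>barrier_value\<close> with a minus sign, a larger slope on the left only lowers the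
  value there.\<close>

lemma above_piece_step:
  fixes a n a' n' :: int
  assumes an: "0 < a" "0 < n" "a' = a + n" "0 < n'"
    and defect: "list_all (\<lambda>c. 0 \<le> c) (moebius (barrier_defect a n zs))"
    and match: "ev zs 1 = ev zs' 0" "ev (pder zs') 0 / n' \<le> ev (pder zs) 1 / n"
    and above: "above (piece a' n' zs') (piece1 a' n' zs') (a' / 100)"
  shows "above (piece a n zs) (piece1 a n zs) (a / 100)"
proof (rule above_piece_backward[OF an(1,2) defect])
  let ?t = "real_of_int (a + n) / 100"
  have t: "0 < ?t" using an by simp
  have x: "(100 * ?t - a) / n = 1" "(100 * ?t - a') / n' = 0" using an by (simp_all add: field_simps)
  have p: "piece a n zs ?t = piece a' n' zs' ?t"
    unfolding piece_def flux_def x match(1) ..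
  have "flux1 a' n' zs' ?t \<le> flux1 a n zs ?t"
    unfolding flux1_def x using match(2) by simp
  then have "piece1 a' n' zs' ?t \<le> piece1 a n zs ?t"
    unfolding piece1_def flux_def x match(1) by (intro diff_right_mono divide_right_mono) simp_all
  then have "barrier_value ?t (piece a n zs ?t) (piece1 a n zs ?t)
      \<le> barrier_value ?t (piece a' n' zs' ?t) (piece1 a' n' zs' ?t)"
    unfolding barrier_value_def p by simp
  then show "above (piece a n zs) (piece1 a n zs) ?t"
    using above an p by (auto simp: above_def)
qed

end

section \<open>The tail barrier and the bound\<close>

text \<open>The tail barrier is \<open>- 1 - 1/t + A e\<^sup>-\<^sup>2\<^sup>t\<close>, where \<open>A\<close> truncates the asymptotic series of the solution of
  \<open>4 A - A' = 2.714\<^sup>2 / t\<^sup>2\<close>, so that its potential is \<open>(2.714 e\<^sup>-\<^sup>t / t)\<^sup>2\<close> up to the truncation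
  error, which has the favourable sign.\<close>

definition amplitude :: "real \<Rightarrow> real" where
  "amplitude t = 2.714\<^sup>2 / 4 * (1 / t ^ 2 - (1 / 2) / t ^ 3 + (3 / 8) / t ^ 4 - (3 / 8) / t ^ 5
     + (15 / 32) / t ^ 6 - (45 / 64) / t ^ 7)"

definition amplitude1 :: "real \<Rightarrow> real" where
  "amplitude1 t = 2.714\<^sup>2 / 4 * ((- 2) / t ^ 3 + (3 / 2) / t ^ 4 - (3 / 2) / t ^ 5 + (15 / 8) / t ^ 6
     - (45 / 16) / t ^ 7 + (315 / 64) / t ^ 8)"

definition amplitude2 :: "real \<Rightarrow> real" where
  "amplitude2 t = 2.714\<^sup>2 / 4 * (6 / t ^ 4 - 6 / t ^ 5 + (15 / 2) / t ^ 6 - (45 / 4) / t ^ 7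
     + (315 / 16) / t ^ 8 - (315 / 8) / t ^ 9)"

definition tail :: "real \<Rightarrow> real" where
  "tail t = - 1 - 1 / t + amplitude t * exp (- 2 * t)"

definition tail1 :: "real \<Rightarrow> real" where
  "tail1 t = 1 / t\<^sup>2 + (amplitude1 t - 2 * amplitude t) * exp (- 2 * t)"

definition tail2 :: "real \<Rightarrow> real" where
  "tail2 t = - 2 / t ^ 3 + (amplitude2 t - 4 * amplitude1 t + 4 * amplitude t) * exp (- 2 * t)"

section \<open>The residual of the tail barrier\<close>

lemma inverse_power_deriv:
  fixes t :: real
  assumes "t \<noteq> 0"
  shows "((\<lambda>t. c / t ^ n) has_real_derivative - (n * c) / t ^ Suc n) (at t)"
  using quotient_power_deriv[OF assms DERIV_const[of c], of n] by simp

lemma amplitude_deriv: "t \<noteq> 0 \<Longrightarrow> (amplitude has_real_derivative amplitude1 t) (at t)"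
  unfolding amplitude_def[abs_def] amplitude1_def
  by (rule DERIV_cong, (rule DERIV_cmult DERIV_add DERIV_diff inverse_power_deriv | assumption)+) simp

lemma amplitude1_deriv: "t \<noteq> 0 \<Longrightarrow> (amplitude1 has_real_derivative amplitude2 t) (at t)"
  unfolding amplitude1_def[abs_def] amplitude2_def
  by (rule DERIV_cong, (rule DERIV_cmult DERIV_add DERIV_diff inverse_power_deriv | assumption)+) simp

lemma tail_deriv: "t \<noteq> 0 \<Longrightarrow> (tail has_real_derivative tail1 t) (at t)"
  unfolding tail_def[abs_def] tail1_def
  by (auto intro!: derivative_eq_intros amplitude_deriv simp: algebra_simps power2_eq_square)

lemma tail1_deriv: "t \<noteq> 0 \<Longrightarrow> (tail1 has_real_derivative tail2 t) (at t)"
  unfolding tail1_def[abs_def] tail2_def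
  by (auto intro!: derivative_eq_intros amplitude_deriv amplitude1_deriv
      simp: field_simps power2_eq_square power3_eq_cube)

text \<open>The coefficient of \<open>1 / t^(k+1)\<close> is \<open>- k / 4\<close> times that of
  \<open>1 / t^k\<close>, so all terms cancel except the first and the derivative of the last.
  Stopping at a negative coefficient gives the error its sign. The second identity is the derivative
  of the first.\<close>

lemma amplitude_defect:
  assumes "t \<noteq> 0"
  shows "4 * amplitude t - amplitude1 t = 2.714\<^sup>2 * (1 / t\<^sup>2 - 315 / (256 * t ^ 8))"
    and "4 * amplitude1 t - amplitude2 t = 2.714\<^sup>2 * (- 2 / t ^ 3 + 315 / (32 * t ^ 9))"
  using assms by (simp_all add: amplitude_def amplitude1_def amplitude2_def field_simps)

lemma amplitude_bounds:
  assumes t: "1 \<le> t"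
  shows "0 < amplitude t" "amplitude t \<le> 2.714\<^sup>2 / 4 / t\<^sup>2"
proof -
  define r where "r = 1 / t"
  have r: "0 < r" "r \<le> 1" using t by (auto simp: r_def)
  have pow: "c / t ^ k = c * r ^ k" for c k by (simp add: r_def power_divide)
  have A: "amplitude t = 2.714\<^sup>2 / 4 * r\<^sup>2 * (1 - r / 2 + 3 / 8 * r ^ 2 - 3 / 8 * r ^ 3 + 15 / 32 * r ^ 4 - 45 / 64 * r ^ 5)"
    unfolding amplitude_def pow by (simp add: field_simps eval_nat_numeral)
  have d: "r ^ 2 \<le> r" "r ^ 3 \<le> r ^ 2" "r ^ 4 \<le> r ^ 3" "r ^ 5 \<le> r ^ 4" "r ^ 4 \<le> 1" "0 < r ^ 5"
    using r power_decreasing[of 1 2 r] power_decreasing[of 2 3 r] power_decreasing[of 3 4 r] power_decreasing[of 4 5 r]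
    by (auto simp: power_le_one)
  have "0 < 1 - r / 2 + 3 / 8 * r ^ 2 - 3 / 8 * r ^ 3 + 15 / 32 * r ^ 4 - 45 / 64 * r ^ 5" using d r by linarith
  then show "0 < amplitude t" unfolding A using r by simp
  have "1 - r / 2 + 3 / 8 * r ^ 2 - 3 / 8 * r ^ 3 + 15 / 32 * r ^ 4 - 45 / 64 * r ^ 5 \<le> 1" using d r by linarith
  then have "amplitude t \<le> 2.714\<^sup>2 / 4 * r\<^sup>2 * 1" unfolding A by (intro mult_left_mono) auto
  then show "amplitude t \<le> 2.714\<^sup>2 / 4 / t\<^sup>2" by (simp add: r_def power_divide)
qed

text \<open>\<open>- 1 - 1 / t\<close> is the logarithmic derivative of
  \<open>exp (- t) / t\<close>, which solves the linear equation, so it has potential 0. Only the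
  correction \<open>amplitude t * exp (- 2 * t)\<close> contributes.\<close>

lemma tail_potential:
  assumes "t \<noteq> 0"
  shows "barrier_potential t (tail t) (tail1 t)
    = (4 * amplitude t - amplitude1 t) * exp (- 2 * t) - (amplitude t * exp (- 2 * t))\<^sup>2"
  using assms by (simp add: barrier_potential_def tail_def tail1_def field_simps power2_eq_square)

lemma tail_residual:
  assumes "t \<noteq> 0"
  shows "barrier_residual t (tail t) (tail1 t) (tail2 t)
    = exp (- 2 * t) * (2.714\<^sup>2 * 945 / (128 * t ^ 9) - (amplitude t)\<^sup>2 * (6 + 2 / t) * exp (- 2 * t)
        + 2 * amplitude t ^ 3 * (exp (- 2 * t))\<^sup>2)"
proof -
  define E where "E = exp (- 2 * t)"
  define A where "A = amplitude t"
  define B where "B = 4 * amplitude t - amplitude1 t"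
  define C where "C = 4 * amplitude1 t - amplitude2 t"
  have A1: "amplitude1 t = 4 * A - B" and A2: "amplitude2 t = 4 * (4 * A - B) - C"
    by (simp_all add: A_def B_def C_def)
  have "barrier_residual t (tail t) (tail1 t) (tail2 t)
    = E * (C + 2 / t * B - A\<^sup>2 * (6 + 2 / t) * E + 2 * A ^ 3 * E\<^sup>2)"
    unfolding barrier_residual_def tail_potential[OF assms] unfolding tail_def tail1_def tail2_def
      A1 A2 A_def[symmetric] E_def[symmetric]
    using assms by (simp add: divide_simps) algebra
  \<comment> \<open>The leading terms in \<open>1 / t^3\<close> cancel; the truncation errors leave
    a positive remainder.\<close>
  also have "C + 2 / t * B = 2.714\<^sup>2 * 945 / (128 * t ^ 9)"
    unfolding B_def C_def amplitude_defect[OF assms] using assms by (simp add: field_simps eval_nat_numeral)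
  finally show ?thesis by (simp add: A_def E_def)
qed

text \<open>This is \<open>exp (- 2 * t)\<close> at \<open>t = 4\<close>, where the tail hands over
  to the first polynomial.\<close>

lemma exp_8_bounds: "335462 / 10 ^ 9 \<le> exp (- 8 :: real)" "exp (- 8 :: real) \<le> 335463 / 10 ^ 9"
proof -
  have e: "2.7182818 \<le> exp (1 :: real)" "exp (1 :: real) \<le> 2.7182819"
  proof -
    have "inverse (2 ^ 32 :: real) \<le> 1 / 10 ^ 9" by simp
    then have "\<bar>exp 1 - 5837465777 / 2147483648 :: real\<bar> \<le> 1 / 10 ^ 9" using e_approx_32 by linarith
    then show "2.7182818 \<le> exp (1 :: real)" "exp (1 :: real) \<le> 2.7182819" unfolding abs_le_iff by auto
  qed
  have e8: "exp (8 :: real) = exp 1 ^ 8" using exp_of_nat_mult[of 8 "1 :: real"] by simp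
  have "exp (8 :: real) \<le> 2.7182819 ^ 8" unfolding e8 using e by (intro power_mono) auto
  also have "(2.7182819 :: real) ^ 8 \<le> 10 ^ 9 / 335462" by (simp add: field_simps eval_nat_numeral)
  finally show "335462 / 10 ^ 9 \<le> exp (- 8 :: real)" by (simp add: exp_minus field_simps)
  have "(10 ^ 9 / 335463 :: real) \<le> 2.7182818 ^ 8" by (simp add: field_simps eval_nat_numeral)
  also have "(2.7182818 :: real) ^ 8 \<le> exp 8" unfolding e8 using e by (intro power_mono) auto
  finally show "exp (- 8 :: real) \<le> 335463 / 10 ^ 9" by (simp add: exp_minus field_simps)
qed

text \<open>The squared amplitude is of order \<open>1 / t^4\<close> and the positive term of order
  \<open>1 / t^9\<close>, so \<open>t ^ 5 * exp (- 2 * t)\<close> has to be small; for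
  \<open>t \<ge> 4\<close> it is at most its value at 4, about 0.3435.\<close>

lemma tail_residual_pos:
  assumes t: "4 \<le> t"
  shows "0 < barrier_residual t (tail t) (tail1 t) (tail2 t)"
proof -
  define E where "E = exp (- 2 * t)"
  have "(t / 4) ^ 5 \<le> exp (t / 4 - 1) ^ 5"
    using t exp_ge_add_one_self[of "t / 4 - 1"] by (intro power_mono) auto
  also have "\<dots> = exp (5 * (t / 4 - 1))" using exp_of_nat_mult[of 5 "t / 4 - 1"] by simp
  also have "\<dots> \<le> exp (2 * t - 8)" using t by simp
  finally have "t ^ 5 \<le> 1024 * exp (2 * t - 8)" by (simp add: power_divide)
  also have "exp (2 * t - 8) = exp (- 8) / E" by (simp add: E_def exp_diff exp_minus field_simps)
  finally have "t ^ 5 * E \<le> 1024 * exp (- 8)" by (simp add: E_def field_simps)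
  then have tE: "t ^ 5 * E \<le> 0.35" using exp_8_bounds(2) by simp
  have A: "0 < amplitude t" "amplitude t \<le> 2.714\<^sup>2 / 4 / t\<^sup>2" using amplitude_bounds t by auto
  have "(amplitude t)\<^sup>2 * (6 + 2 / t) * E \<le> (2.714\<^sup>2 / 4 / t\<^sup>2)\<^sup>2 * 6.5 * E"
    using A t by (intro mult_right_mono mult_mono power_mono) (auto simp: E_def field_simps)
  also have "\<dots> = (2.714\<^sup>2 / 4)\<^sup>2 * 6.5 * (t ^ 5 * E) / t ^ 9"
    using t by (simp add: field_simps eval_nat_numeral)
  also have "\<dots> \<le> (2.714\<^sup>2 / 4)\<^sup>2 * 6.5 * 0.35 / t ^ 9"
    using tE t by (intro divide_right_mono mult_left_mono) auto
  also have "\<dots> < 2.714\<^sup>2 * 945 / (128 * t ^ 9)"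
    using t by (simp add: divide_simps power2_eq_square)
  finally have "0 < 2.714\<^sup>2 * 945 / (128 * t ^ 9) - (amplitude t)\<^sup>2 * (6 + 2 / t) * E"
    by simp
  moreover have "0 < 2 * amplitude t ^ 3 * E\<^sup>2" using A by (simp add: E_def)
  ultimately have "0 < 2.714\<^sup>2 * 945 / (128 * t ^ 9) - (amplitude t)\<^sup>2 * (6 + 2 / t) * E
      + 2 * amplitude t ^ 3 * E\<^sup>2" by linarith
  then have "0 < E * (2.714\<^sup>2 * 945 / (128 * t ^ 9) - (amplitude t)\<^sup>2 * (6 + 2 / t) * E
      + 2 * amplitude t ^ 3 * E\<^sup>2)" by (intro mult_pos_pos) (simp add: E_def)
  then show ?thesis using t by (simp only: tail_residual E_def)
qed

section \<open>Contradiction through the chain of barriers\<close>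

context ground_state begin

text \<open>By monotonicity \<open>t Q e^t\<close> stays above 2.714 after \<open>s\<close>, so
  \<open>Q^2\<close> exceeds the tail potential. The comparison at infinity then applies and is
  carried back to 4.\<close>

lemma above_tail:
  assumes s: "0 < s" "2.714 * (1 / s) * exp (- s) < Q s"
  shows "above tail tail1 4"
proof -
  have g: "s * Q s * exp s \<le> t * Q t * exp t" if "s \<le> t" for t
  proof -
    have "u s * exp s \<le> u t * exp t"
    proof (rule has_derivative_nonneg_imp_le[OF that])
      fix r assume "r \<in> {s..t}"
      then have r: "0 < r" using s by simp
      show "((\<lambda>t. u t * exp t) has_real_derivative (u1 r + u r) * exp r) (at r)"
        by (auto intro!: derivative_eq_intros u_deriv r simp: algebra_simps)
      show "0 \<le> (u1 r + u r) * exp r" using u_plus_u1_pos[OF r] by simp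
    qed
    then show ?thesis by (simp add: u_def)
  qed
  have "2.714 < s * Q s * exp s" using s by (simp add: exp_minus field_simps)
  then have "2.714 < t * Q t * exp t" if "s \<le> t" for t using g[OF that] by linarith
  then have Qt: "2.714\<^sup>2 * exp (- 2 * t) / t\<^sup>2 < (Q t)\<^sup>2" if "s \<le> t" for t
  proof -
    have "2.714\<^sup>2 < (t * Q t * exp t)\<^sup>2"
      using \<open>\<And>t. s \<le> t \<Longrightarrow> 2.714 < t * Q t * exp t\<close>[OF that] by (intro power_strict_mono) auto
    then have "2.714\<^sup>2 * (exp (- 2 * t) / t\<^sup>2) < (t * Q t * exp t)\<^sup>2 * (exp (- 2 * t) / t\<^sup>2)"
      using that s by (intro mult_strict_right_mono) auto
    moreover have "(exp t)\<^sup>2 * exp (- 2 * t) = 1"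
      by (simp add: power2_eq_square flip: exp_add)
    then have "(t * Q t * exp t)\<^sup>2 * (exp (- 2 * t) / t\<^sup>2) = (Q t)\<^sup>2"
      using that s by (simp add: power_mult_distrib)
    ultimately show ?thesis by simp
  qed
  define T where "T = max 4 s"
  have T: "4 \<le> t" "s \<le> t" "t \<noteq> 0" "1 \<le> t" if "T \<le> t" for t using that by (auto simp: T_def)
  have "\<forall>\<^sub>F t in at_top. above tail tail1 t"
  proof (rule eventually_above[of T tail tail1 tail2])
    show "barrier_potential t (tail t) (tail1 t) < (Q t)\<^sup>2" if "T \<le> t" for t
    proof -
      have "barrier_potential t (tail t) (tail1 t) \<le> (4 * amplitude t - amplitude1 t) * exp (- 2 * t)"
        using tail_potential[OF T(3)[OF that]] by simp
      also have "\<dots> \<le> 2.714\<^sup>2 * (1 / t\<^sup>2) * exp (- 2 * t)"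
        unfolding amplitude_defect(1)[OF T(3)[OF that]] using T[OF that] by (intro mult_right_mono mult_left_mono) auto
      also have "\<dots> < (Q t)\<^sup>2" using Qt[OF T(2)[OF that]] by simp
      finally show ?thesis .
    qed
    show "(tail \<longlongrightarrow> - 1) at_top" unfolding tail_def amplitude_def by real_asymp
    show "(tail1 \<longlongrightarrow> 0) at_top" unfolding tail1_def amplitude_def amplitude1_def by real_asymp
  qed (use T tail_residual_pos tail_deriv tail1_deriv in auto)
  then obtain b where b: "4 \<le> b" "above tail tail1 b"
    using eventually_ge_at_top[of "4 :: real"]
    by (metis (mono_tags, lifting) eventually_at_top_linorder linorder_linear order.trans)
  show ?thesis
    by (rule above_backward[of 4 b tail tail1 tail2, OF _ b(1) _ _ _ b(2)])
      (auto intro!: tail_deriv tail1_deriv tail_residual_pos less_imp_le)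
qed

lemma above_barrier_1:
  assumes "above tail tail1 4"
  shows "above (piece 240 160 barrier_1) (piece1 240 160 barrier_1) (240 / 100)"
proof -
  define E :: real where "E = exp (- 8)"
  have E: "335462 / 10 ^ 9 \<le> E" "E \<le> 335463 / 10 ^ 9" using exp_8_bounds by (auto simp: E_def)
  have flux: "flux 240 160 barrier_1 4 = - 19999447917237 / 1000000000000"
    "flux1 240 160 barrier_1 4 = - 7200871975267 / 800000000000"
    by (simp_all add: flux_def flux1_def barrier_1_def)
  have amplitude: "amplitude 4 = 107855509379 / 1048576000000" "amplitude1 4 = - 1637048161 / 33554432000"
    by (simp_all add: amplitude_def amplitude1_def power2_eq_square)
  define p where "p = piece 240 160 barrier_1 4"
  have p: "p = - 19999447917237 / 16000000000000" "piece1 240 160 barrier_1 4 = 3994535958139 / 64000000000000"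
    by (simp_all add: p_def piece_def piece1_def flux)
  have tail: "tail 4 = - 5 / 4 + amplitude 4 * E" "tail1 4 = 1 / 16 + (amplitude1 4 - 2 * amplitude 4) * E"
    by (simp_all add: tail_def tail1_def E_def)
  have "p \<le> tail 4" unfolding p tail amplitude using E by simp
  moreover have "barrier_value 4 p (piece1 240 160 barrier_1 4) \<le> barrier_value 4 (tail 4) (tail1 4)"
  proof -
    \<comment> \<open>The value of the tail is quadratic in \<open>E\<close>. Replacing the square
      by its tangent at \<open>p\<close> leaves an inequality linear in \<open>E\<close>, to be
      checked on the enclosure of \<open>exp (- 8)\<close>.\<close>
    have "p * tail 4 - p\<^sup>2 / 2 \<le> (tail 4)\<^sup>2 / 2"
      using zero_le_power2[of "tail 4 - p"] by (simp add: power2_diff mult.commute)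
    moreover have "p\<^sup>2 + p / 12 - piece1 240 160 barrier_1 4 / 2 \<le> p * tail 4 + tail 4 / 12 - tail1 4 / 2"
      unfolding p tail amplitude using E by (simp add: power2_eq_square field_simps)
    ultimately show ?thesis by (simp add: barrier_value_def)
  qed
  ultimately have "above (piece 240 160 barrier_1) (piece1 240 160 barrier_1) ((240 + 160) / 100)"
    using assms by (auto simp: above_def p_def)
  then show ?thesis
    using above_piece_backward[OF _ _ barrier_1_defect] by simp
qed

lemma not_above_tail: "\<not> above tail tail1 4"
proof
  assume "above tail tail1 4"
  then have "above (piece 240 160 barrier_1) (piece1 240 160 barrier_1) (240 / 100)"
    by (rule above_barrier_1)
  then have "above (piece 130 110 barrier_2) (piece1 130 110 barrier_2) (130 / 100)"
    using above_piece_step[OF _ _ _ _ barrier_2_defect, of 240 160 barrier_1]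
    by (simp add: barrier_1_def barrier_2_def)
  then have "above (piece 60 70 barrier_3) (piece1 60 70 barrier_3) (60 / 100)"
    using above_piece_step[OF _ _ _ _ barrier_3_defect, of 130 110 barrier_2]
    by (simp add: barrier_2_def barrier_3_def)
  then have "above (piece 20 40 barrier_4) (piece1 20 40 barrier_4) (20 / 100)"
    using above_piece_step[OF _ _ _ _ barrier_4_defect, of 60 70 barrier_3]
    by (simp add: barrier_3_def barrier_4_def)
  then have "above (piece 3 17 barrier_5) (piece1 3 17 barrier_5) (3 / 100)"
    using above_piece_step[OF _ _ _ _ barrier_5_defect, of 20 40 barrier_4]
    by (simp add: barrier_4_def barrier_5_def)
  then have "above (piece 1 2 barrier_6) (piece1 1 2 barrier_6) (1 / 100)"
    using above_piece_step[OF _ _ _ _ barrier_6_defect, of 3 17 barrier_5]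
    by (simp add: barrier_5_def barrier_6_def)
  \<comment> \<open>Here the polynomial variable is 0, so the barrier has the sign of the constant
    coefficient 9089898 of \<open>barrier_6\<close>.\<close>
  then have "0 < q (1 / 100)"
    by (auto simp: above_def piece_def flux_def barrier_6_def power2_eq_square)
  then have "0 < Q1 (1 / 100)"
    using Q_pos[of "1 / 100"] by (simp add: q_def zero_less_divide_iff)
  then show False using Q1_nonpos[of "1 / 100"] by simp
qed

lemma decay_bound: "0 < t \<Longrightarrow> Q t \<le> 2.714 * (1 / t) * exp (- t)"
  using above_tail[of t] not_above_tail by (meson not_le)

end

theorem lemma4p1:
  fixes Q :: "real \<Rightarrow> real"
  assumes "ground_state_profile Q"
  shows "(\<forall>t\<ge>2.5. 0 < Q t \<and> Q t \<le> 2.714 * (1 / t) * exp (- t)) \<and>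
         (\<forall>t\<ge>5. 3 * (Q t) ^ 2 \<le> exp (- 2 * t))"
proof -
  obtain Q1 Q2 where "ground_state Q Q1 Q2"
    using assms unfolding ground_state_profile_def ground_state_def by blast
  then interpret ground_state Q Q1 Q2 .
  have "3 * (Q t)\<^sup>2 \<le> exp (- 2 * t)" if t: "5 \<le> t" for t
  proof -
    have "Q t \<le> 2.714 * (1 / t) * exp (- t)" using decay_bound t by simp
    also have "\<dots> \<le> 2.714 * (1 / 5) * exp (- t)"
      using t by (intro mult_right_mono mult_left_mono) (auto simp: field_simps)
    finally have "(Q t)\<^sup>2 \<le> (2.714 * (1 / 5) * exp (- t))\<^sup>2"
      using Q_pos[of t] t by (intro power_mono) auto
    also have "\<dots> = (2.714 * (1 / 5))\<^sup>2 * exp (- 2 * t)"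
      by (simp add: power_mult_distrib power2_eq_square flip: exp_add)
    finally have "3 * (Q t)\<^sup>2 \<le> (3 * (2.714 * (1 / 5))\<^sup>2) * exp (- 2 * t)" by simp
    \<comment> \<open>\<open>3 * (2.714 / 5)^2\<close> is about 0.884.\<close>
    also have "\<dots> \<le> 1 * exp (- 2 * t)" by (intro mult_right_mono) (auto simp: power2_eq_square)
    finally show ?thesis by simp
  qed
  then show ?thesis using Q_pos decay_bound by auto
qed

end
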